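(* Let $d \geq 2$ be an integer, let $K$ be a global field whose characteristic is either $0$ or greater than $d$, and let $\phi \in K(x)$ be a post-critically finite rational function of degree $d$ such that for every $n \geq 1$ the equation $\phi^n(x) = 0$ has $d^n$ distinct solutions in $\mathbb{P}^1(K^{\mathrm{sep}})$. Let $T_\infty$ be the infinite rooted $d$-ary tree of iterated pre-images of $0$ under $\phi$, and let $G_\infty(\phi) \leq \mathrm{Aut}(T_\infty)$ be the image of the action of $\mathrm{Gal}(K^{\mathrm{sep}}/K)$ on $T_\infty$. Then the index $[\mathrm{Aut}(T_\infty) : G_\infty(\phi)]$ is infinite.
   Context: A global field is a number field or a function field of one variable over a finite field. $K^{\mathrm{sep}}$ denotes a separable closure of $K$. For $\phi \in K(x)$ of degree $d \geq 2$, $\phi^n$ denotes the $n$-fold composition of $\phi$ with itself, with $\phi^0$ the identity. A rational function $\phi$ is post-critically finite if the forward orbit $\{\phi^n(c) : n \geq 0\}$ of each of its critical points $c \in \mathbb{P}^1(\overline{K})$ is finite. The tree $T_\infty$ has vertex set the disjoint union $\bigsqcup_{n \geq 0} \phi^{-n}(0)$ with $\phi^{-n}(0) \subseteq \mathbb{P}^1(K^{\mathrm{sep}})$ and $\phi^{0}(0)=0$ as root; a vertex $\beta \in \phi^{-(n+1)}(0)$ is joined by an edge to the vertex $\phi(\beta) \in \phi^{-n}(0)$. Since each $\phi^{-n}(0)$ has exactly $d^n$ elements, $T_\infty$ is a complete infinite rooted $d$-ary tree. $\mathrm{Aut}(T_\infty)$ is the group of all automorphisms of this rooted tree. Because $\phi$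 is defined over $K$, elements of $\mathrm{Gal}(K^{\mathrm{sep}}/K)$ commute with $\phi$, so $\mathrm{Gal}(K^{\mathrm{sep}}/K)$ acts on $T_\infty$ by tree automorphisms, giving a homomorphism $\rho : \mathrm{Gal}(K^{\mathrm{sep}}/K) \to \mathrm{Aut}(T_\infty)$; by definition $G_\infty(\phi) = \mathrm{im}\,\rho$. Equivalently, $G_\infty(\phi)$ is the inverse limit of the Galois groups $\mathrm{Gal}(K(\phi^{-n}(0))/K)$. *)

theory Defs
  imports "HOL-Algebra.Bij" "HOL-Algebra.Generated_Fields" "HOL-Algebra.Algebraic_Closure_Type"
begin

section \<open>Global fields\<close>

text \<open>
  The ground field is a type of class \<^class>\<open>field\<close>; subfields and field extensions inside it are
  expressed through HOL-Algebra, applied to the field as a ring with carrier \<^term>\<open>UNIV\<close>.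
\<close>

abbreviation (input) type_ring :: "'a::field itself \<Rightarrow> 'a ring" where
  "type_ring _ \<equiv> ring_of_type_algebra"

text \<open>In characteristic 0, the subfield generated by the empty set is the field of rationals.\<close>

definition number_field :: "'a::field itself \<Rightarrow> bool" where
  "number_field T \<longleftrightarrow>
     CHAR('a) = 0 \<and>
     ring.finite_dimension (type_ring T) (generate_field (type_ring T) {}) UNIV"

text \<open>
  A function field of one variable over a finite field \<open>k\<close> is a finite extension of \<open>k(t)\<close>
  for some \<open>t\<close> that is transcendental over \<open>k\<close>.
\<close>

definition finite_function_field :: "'a::field itself \<Rightarrow> bool" where
  "finite_function_field T \<longleftrightarrow>
     (\<exists>k t. subfield k (type_ring T) \<and> finite k \<and>
            ring.transcendental (type_ring T) k t \<and>
            ring.finite_dimension (type_ring T) (generate_field (type_ring T) (insert t k)) UNIV)"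

definition global_field :: "'a::field itself \<Rightarrow> bool" where
  "global_field T \<longleftrightarrow> number_field T \<or> finite_function_field T"


section \<open>The separable closure and its Galois group\<close>

text \<open>
  The separable closure is taken inside the algebraic closure: an element belongs to it iff it is
  a root of an irreducible polynomial over the ground field without multiple roots.
\<close>

definition sep_closure :: "'a::field alg_closure set" where
  "sep_closure =
     {x. \<exists>f :: 'a poly. irreducible f \<and> rsquarefree (map_poly to_ac f) \<and>
           poly (map_poly to_ac f) x = 0}"

lemma to_ac_in_sep_closure: "to_ac a \<in> sep_closure"
proof -
  have "order x (map_poly to_ac [:-a, 1:]) \<le> 1" for x
    using order_degree[of "map_poly to_ac [:-a, 1:]" x] by (simp add: map_poly_pCons)
  hence "rsquarefree (map_poly to_ac [:-a, 1:])"
    by (auto simp: rsquarefree_def map_poly_pCons le_Suc_eq)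
  moreover have "irreducible [:-a, 1:]"
    by (rule irreducible_linear_field_poly) simp
  moreover have "poly (map_poly to_ac [:-a, 1:]) (to_ac a) = 0"
    by (simp add: map_poly_pCons)
  ultimately show ?thesis
    unfolding sep_closure_def by blast
qed

text \<open>Automorphisms are extensional functions, as in \<^const>\<open>Bij\<close>.\<close>

definition galois_sep :: "('a::field alg_closure \<Rightarrow> 'a alg_closure) set" where
  "galois_sep =
     {\<sigma> \<in> Bij sep_closure.
        (\<forall>x\<in>sep_closure. \<forall>y\<in>sep_closure. \<sigma> (x + y) = \<sigma> x + \<sigma> y) \<and>
        (\<forall>x\<in>sep_closure. \<forall>y\<in>sep_closure. \<sigma> (x * y) = \<sigma> x * \<sigma> y) \<and>
        (\<forall>a. \<sigma> (to_ac a) = to_ac a)}"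


section \<open>Rational functions on the projective line\<close>

datatype 'a proj_line = Fin 'a | Infty

definition proj_line_over :: "'a set \<Rightarrow> 'a proj_line set" where
  "proj_line_over S = insert Infty (Fin ` S)"

text \<open>Numerator and denominator in lowest terms.\<close>

definition lowest_terms :: "'a::field poly fract \<Rightarrow> 'a poly \<times> 'a poly \<Rightarrow> bool" where
  "lowest_terms \<phi> = (\<lambda>(p, q). \<phi> = Fract p q \<and> coprime p q \<and> lead_coeff q = 1)"

definition ratfun_num :: "'a::field poly fract \<Rightarrow> 'a poly" where
  "ratfun_num \<phi> = fst (SOME r. lowest_terms \<phi> r)"

definition ratfun_den :: "'a::field poly fract \<Rightarrow> 'a poly" where
  "ratfun_den \<phi> = snd (SOME r. lowest_terms \<phi> r)"

lemma lowest_terms_exists: "\<exists>r. lowest_terms \<phi> r"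
proof -
  define P where "P = (\<lambda>n. \<exists>p q. \<phi> = Fract p q \<and> q \<noteq> 0 \<and> degree q = n)"
  obtain a b where "\<phi> = Fract a b" "b \<noteq> 0"
    by (cases \<phi>)
  hence "P (degree b)"
    by (auto simp: P_def)
  hence "P (LEAST n. P n)"
    by (rule LeastI)
  then obtain p q where pq: "\<phi> = Fract p q" "q \<noteq> 0" "degree q = (LEAST n. P n)"
    by (auto simp: P_def)
  have "coprime p q"
  proof (rule coprimeI)
    fix c assume "c dvd p" "c dvd q"
    then obtain p' q' where c: "p = c * p'" "q = c * q'"
      by (auto elim!: dvdE)
    with pq have nz: "c \<noteq> 0" "q' \<noteq> 0"
      by auto
    hence "\<phi> = Fract p' q'"
      using pq c by (simp add: eq_fract)
    hence "P (degree q')"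
      using nz by (auto simp: P_def)
    hence "degree q \<le> degree q'"
      using pq Least_le by metis
    hence "degree c = 0"
      using nz c by (simp add: degree_mult_eq)
    thus "is_unit c"
      using nz is_unit_iff_degree by blast
  qed
  hence "coprime (smult (inverse (lead_coeff q)) p) (smult (inverse (lead_coeff q)) q)"
    using pq(2) by (auto simp: coprime_def dvd_smult_iff)
  moreover have
    "\<phi> = Fract (smult (inverse (lead_coeff q)) p) (smult (inverse (lead_coeff q)) q)"
    using pq(1,2) by (simp add: eq_fract)
  ultimately have
    "lowest_terms \<phi> (smult (inverse (lead_coeff q)) p, smult (inverse (lead_coeff q)) q)"
    using pq(2) by (simp add: lowest_terms_def)
  thus ?thesis ..
qed

lemma lowest_terms_ratfun: "lowest_terms \<phi> (ratfun_num \<phi>, ratfun_den \<phi>)"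
  using someI_ex[OF lowest_terms_exists[of \<phi>]]
  by (simp add: ratfun_num_def ratfun_den_def)

definition ratfun_degree :: "'a::field poly fract \<Rightarrow> nat" where
  "ratfun_degree \<phi> = max (degree (ratfun_num \<phi>)) (degree (ratfun_den \<phi>))"

abbreviation ac_num :: "'a::field poly fract \<Rightarrow> 'a alg_closure poly" where
  "ac_num \<phi> \<equiv> map_poly to_ac (ratfun_num \<phi>)"

abbreviation ac_den :: "'a::field poly fract \<Rightarrow> 'a alg_closure poly" where
  "ac_den \<phi> \<equiv> map_poly to_ac (ratfun_den \<phi>)"

text \<open>
  The self-map of the projective line over the algebraic closure. At infinity, it is read off
  from the coefficients of degree \<^term>\<open>ratfun_degree \<phi>\<close>, not both of which vanish.
\<close>

definition ratfun_eval ::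
  "'a::field poly fract \<Rightarrow> 'a alg_closure proj_line \<Rightarrow> 'a alg_closure proj_line" where
  "ratfun_eval \<phi> x =
     (let (u, v) =
        (case x of
           Fin a \<Rightarrow> (poly (ac_num \<phi>) a, poly (ac_den \<phi>) a)
         | Infty \<Rightarrow> (coeff (ac_num \<phi>) (ratfun_degree \<phi>), coeff (ac_den \<phi>) (ratfun_degree \<phi>)))
      in if v = 0 then Infty else Fin (u / v))"

text \<open>
  A polynomial whose roots are the finite solutions of \<open>\<phi>(x) = y\<close>, with multiplicity.
  Regarded as a binary form of degree \<^term>\<open>ratfun_degree \<phi>\<close>, its order of vanishing at infinity
  is the amount by which its degree drops.
\<close>

definition fibre_poly ::
  "'a::field poly fract \<Rightarrow> 'a alg_closure proj_line \<Rightarrow> 'a alg_closure poly" where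
  "fibre_poly \<phi> y =
     (case y of Fin b \<Rightarrow> ac_num \<phi> - smult b (ac_den \<phi>) | Infty \<Rightarrow> ac_den \<phi>)"

definition ramification_index :: "'a::field poly fract \<Rightarrow> 'a alg_closure proj_line \<Rightarrow> nat" where
  "ramification_index \<phi> x =
     (let F = fibre_poly \<phi> (ratfun_eval \<phi> x)
      in case x of Fin a \<Rightarrow> order a F | Infty \<Rightarrow> ratfun_degree \<phi> - degree F)"

definition critical_point :: "'a::field poly fract \<Rightarrow> 'a alg_closure proj_line \<Rightarrow> bool" where
  "critical_point \<phi> c \<longleftrightarrow> ramification_index \<phi> c > 1"

definition post_critically_finite :: "'a::field poly fract \<Rightarrow> bool" where
  "post_critically_finite \<phi> \<longleftrightarrow>
     (\<forall>c. critical_point \<phi> c \<longrightarrow> finite {(ratfun_eval \<phi> ^^ n) c | n. True})"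


section \<open>The tree of iterated preimages of 0\<close>

definition iterated_preimage :: "'a::field poly fract \<Rightarrow> nat \<Rightarrow> 'a alg_closure proj_line set" where
  "iterated_preimage \<phi> n =
     {\<beta> \<in> proj_line_over sep_closure. (ratfun_eval \<phi> ^^ n) \<beta> = Fin 0}"

definition tree_verts :: "'a::field poly fract \<Rightarrow> (nat \<times> 'a alg_closure proj_line) set" where
  "tree_verts \<phi> = (SIGMA n:UNIV. iterated_preimage \<phi> n)"

definition tree_root :: "nat \<times> 'a::field alg_closure proj_line" where
  "tree_root = (0, Fin 0)"

definition tree_edges :: "'a::field poly fract \<Rightarrow> (nat \<times> 'a alg_closure proj_line) set set" where
  "tree_edges \<phi> =
     {{(Suc n, \<beta>), (n, ratfun_eval \<phi> \<beta>)} | n \<beta>. \<beta> \<in> iterated_preimage \<phi> (Suc n)}"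

definition rooted_graph_auts :: "'v set \<Rightarrow> 'v set set \<Rightarrow> 'v \<Rightarrow> ('v \<Rightarrow> 'v) set" where
  "rooted_graph_auts V E r =
     {f \<in> Bij V. f r = r \<and> (\<forall>x\<in>V. \<forall>y\<in>V. {f x, f y} \<in> E \<longleftrightarrow> {x, y} \<in> E)}"

lemma subgroup_rooted_graph_auts:
  assumes "r \<in> V"
  shows "subgroup (rooted_graph_auts V E r) (BijGroup V)"
proof (rule group.subgroupI[OF group_BijGroup])
  show "rooted_graph_auts V E r \<subseteq> carrier (BijGroup V)"
    by (auto simp: rooted_graph_auts_def BijGroup_def)
  have "(\<lambda>x\<in>V. x) \<in> rooted_graph_auts V E r"
    using assms by (auto simp: rooted_graph_auts_def id_Bij)
  thus "rooted_graph_auts V E r \<noteq> {}"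
    by blast
next
  fix f assume f: "f \<in> rooted_graph_auts V E r"
  hence Bij: "f \<in> Bij V"
    by (simp add: rooted_graph_auts_def)
  have bij: "bij_betw f V V"
    using Bij by (simp add: Bij_def)
  have mem: "inv_into V f x \<in> V" "f (inv_into V f x) = x" if "x \<in> V" for x
    using that bij Bij_inv_into_mem[OF Bij] bij_betw_inv_into_right by metis+
  have "inv_into V f r = r"
    using f assms bij bij_betw_inv_into_left by (fastforce simp: rooted_graph_auts_def)
  moreover have "{inv_into V f x, inv_into V f y} \<in> E \<longleftrightarrow> {x, y} \<in> E"
    if "x \<in> V" "y \<in> V" for x y
  proof -
    have "{f (inv_into V f x), f (inv_into V f y)} \<in> E \<longleftrightarrow>
            {inv_into V f x, inv_into V f y} \<in> E"
      using f mem(1)[OF that(1)] mem(1)[OF that(2)] unfolding rooted_graph_auts_def by blast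
    thus ?thesis
      by (simp add: mem(2) that)
  qed
  ultimately show "inv\<^bsub>BijGroup V\<^esub> f \<in> rooted_graph_auts V E r"
    using Bij assms
    by (auto simp: rooted_graph_auts_def inv_BijGroup restrict_inv_into_Bij)
next
  fix f g assume "f \<in> rooted_graph_auts V E r" "g \<in> rooted_graph_auts V E r"
  thus "f \<otimes>\<^bsub>BijGroup V\<^esub> g \<in> rooted_graph_auts V E r"
    using assms Bij_imp_funcset[of g V]
    by (auto simp: rooted_graph_auts_def BijGroup_def compose_Bij compose_eq Pi_iff)
qed

definition tree_aut_group ::
  "'a::field poly fract \<Rightarrow> (nat \<times> 'a alg_closure proj_line \<Rightarrow> nat \<times> 'a alg_closure proj_line) monoid"
  where
  "tree_aut_group \<phi> =
     BijGroup (tree_verts \<phi>)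
       \<lparr>carrier := rooted_graph_auts (tree_verts \<phi>) (tree_edges \<phi>) tree_root\<rparr>"

lemma group_tree_aut_group: "group (tree_aut_group \<phi>)"
proof -
  have "tree_root \<in> tree_verts \<phi>"
    using to_ac_in_sep_closure[of 0]
    by (auto simp: tree_root_def tree_verts_def iterated_preimage_def proj_line_over_def)
  thus ?thesis
    unfolding tree_aut_group_def
    by (intro subgroup.subgroup_is_group subgroup_rooted_graph_auts group_BijGroup)
qed

definition galois_tree_action ::
  "'a::field poly fract \<Rightarrow> ('a alg_closure \<Rightarrow> 'a alg_closure) \<Rightarrow>
     nat \<times> 'a alg_closure proj_line \<Rightarrow> nat \<times> 'a alg_closure proj_line" where
  "galois_tree_action \<phi> \<sigma> = (\<lambda>(n, \<beta>) \<in> tree_verts \<phi>. (n, map_proj_line \<sigma> \<beta>))"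

definition arboreal_galois_group ::
  "'a::field poly fract \<Rightarrow> (nat \<times> 'a alg_closure proj_line \<Rightarrow> nat \<times> 'a alg_closure proj_line) set"
  where
  "arboreal_galois_group \<phi> = galois_tree_action \<phi> ` galois_sep"

end

theory Submission
  imports Defs
begin

text \<open>
  An element of the Galois group permutes the \<open>d ^ n\<close> points of level \<open>n\<close> of the tree, and the sign
  of this permutation is governed by a square root of the discriminant of the level. In
  \<open>Aut T\<^sub>\<infinity>\<close> the signs on different levels are independent of each other: for every level there
  is an automorphism that is trivial below it and a transposition on it. The proof
  shows that on the Galois group the signs are dependent: there are \<open>n\<close> and \<open>p > 0\<close> such that the
  signs on the levels \<open>n, n + p, n + 2 * p, \<dots>\<close> all agree. Then transpositions on the levels
  \<open>n + p, n + 2 * p, \<dots>\<close> lie in different cosets (\<open>infinite_index\<close>).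

  The dependence of the signs comes from the discriminants being equal up to squares of elements
  that Galois automorphisms fix, and this is a computation with resultants. The discriminant of
  level \<open>n + 1\<close> is expressed in \<open>disc_Suc\<close> by the discriminant of level \<open>n\<close>, a constant, and the
  product \<open>E (n + 1)\<close> of the values of the Wronskian \<open>P' * Q - P * Q'\<close> over level \<open>n + 1\<close>. The zeros
  of the Wronskian are the critical points \<open>c\<close> of \<open>\<phi>\<close>, so up to squares \<open>E n\<close> is a product over
  them of the values of the numerator of \<open>\<phi>\<^sup>n\<close>, times a power of the leading coefficient of the
  Wronskian. When the orbits of the critical points have become periodic with common period
  \<open>r\<close>, the quotient of \<open>E (n + r)\<close> by \<open>E n\<close>, normalised by squares, is raised to the \<open>d\<close>-th power
  in each step (\<open>wronskian_norm_recurrence\<close>). A parity argument in the group of square classes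
  turns this into periodicity of the classes of the discriminants with period \<open>4 * r\<close>
  (\<open>sq_periodic\<close>).

  The individual critical points need not be separable over the ground field. Only products over
  levels of the tree are shown to be fixed by the Galois group; products over critical points
  occur solely as a means to relate them.

  Galois automorphisms are maps of the separable closure, and applying them to polynomial
  expressions requires that separable elements form a ring. In characteristic \<open>p\<close> this is derived
  from the criterion that \<open>x\<close> is separable if and only if \<open>x\<close> is a polynomial in \<open>x ^ p\<close>
  (\<open>sep_closure_iff_frobenius\<close>) and a dimension count.
\<close>

section \<open>Separable elements form a subring\<close>

lemma map_poly_to_ac_add: "map_poly to_ac (f + g) = map_poly to_ac f + map_poly to_ac g"
  by (rule poly_eqI) (simp add: coeff_map_poly)

lemma map_poly_to_ac_mult: "map_poly to_ac (f * g) = map_poly to_ac f * map_poly to_ac g"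
  by (rule poly_eqI) (simp add: coeff_map_poly coeff_mult to_ac_sum)

lemma map_poly_to_ac_diff: "map_poly to_ac (f - g) = map_poly to_ac f - map_poly to_ac g"
  by (rule poly_eqI) (simp add: coeff_map_poly)

lemma map_poly_to_ac_pcompose:
  "map_poly to_ac (pcompose g q) = pcompose (map_poly to_ac g) (map_poly to_ac q)"
  by (induction g)
    (simp_all add: pcompose_pCons map_poly_pCons map_poly_to_ac_add map_poly_to_ac_mult)

lemma degree_map_poly_to_ac [simp]: "degree (map_poly to_ac f) = degree f"
  by (rule degree_map_poly) simp

lemma map_poly_to_ac_eq_0_iff [simp]: "map_poly to_ac f = 0 \<longleftrightarrow> f = 0"
  by (simp add: map_poly_eq_0_iff)

lemma pderiv_map_poly_to_ac: "pderiv (map_poly to_ac f) = map_poly to_ac (pderiv f)"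
  by (rule poly_eqI) (simp add: coeff_pderiv coeff_map_poly del: of_nat_Suc)

lemma poly_map_poly_to_ac_lessThan:
  assumes "\<And>i. i \<ge> n \<Longrightarrow> coeff f i = 0"
  shows "poly (map_poly to_ac f) x = (\<Sum>i<n. to_ac (coeff f i) * x ^ i)"
proof -
  have "poly (map_poly to_ac f) x = (\<Sum>i\<le>degree f. to_ac (coeff f i) * x ^ i)"
    by (simp add: poly_altdef coeff_map_poly)
  also have "\<dots> = (\<Sum>i<n. to_ac (coeff f i) * x ^ i)"
    using assms by (intro sum.mono_neutral_cong) (auto simp: coeff_eq_0 not_less not_le)
  finally show ?thesis .
qed

lemma degree_pderiv_le: "degree f \<le> n \<Longrightarrow> degree (pderiv f) \<le> n - 1" for f :: "'a::field poly"
  by (rule degree_le) (auto simp: coeff_pderiv coeff_eq_0)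

lemma degree_pos_if_root:
  assumes "f \<noteq> 0" "poly (map_poly to_ac f) x = 0"
  shows "degree f > 0"
proof (rule ccontr)
  assume "\<not> degree f > 0"
  then obtain c where "f = [:c:]"
    using degree_eq_zeroE by auto
  thus False
    using assms by (simp add: map_poly_pCons)
qed

lemma min_poly_exists:
  fixes x :: "'a::field alg_closure"
  obtains f :: "'a poly" where "irreducible f" "poly (map_poly to_ac f) x = 0"
    "\<And>g. poly (map_poly to_ac g) x = 0 \<Longrightarrow> f dvd g"
proof -
  define P where "P = (\<lambda>n. \<exists>f :: 'a poly. f \<noteq> 0 \<and> poly (map_poly to_ac f) x = 0 \<and> degree f = n)"
  have "\<exists>n. P n"
    by (metis P_def alg_closure_algebraic)
  hence "P (LEAST n. P n)"
    by (rule LeastI_ex)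
  then obtain f :: "'a poly" where f: "f \<noteq> 0" "poly (map_poly to_ac f) x = 0"
    "degree f = (LEAST n. P n)"
    by (auto simp: P_def)
  have least: "degree f \<le> degree g" if "g \<noteq> 0" "poly (map_poly to_ac g) x = 0" for g :: "'a poly"
    unfolding f(3) using that by (intro Least_le) (auto simp: P_def)
  have dvd: "f dvd g" if g: "poly (map_poly to_ac g) x = 0" for g :: "'a poly"
  proof (rule ccontr)
    assume "\<not> f dvd g"
    hence nz: "g mod f \<noteq> 0"
      by (simp add: dvd_eq_mod_eq_0)
    have "poly (map_poly to_ac (f * (g div f) + g mod f)) x = 0"
      using g by simp
    hence "poly (map_poly to_ac (g mod f)) x = 0"
      using f(2) unfolding map_poly_to_ac_add map_poly_to_ac_mult by simp
    hence "degree f \<le> degree (g mod f)"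
      using least nz by blast
    thus False
      using degree_mod_less[OF f(1), of g] nz by simp
  qed
  have "irreducible f"
  proof (rule irreducibleI)
    show "\<not> f dvd 1"
      using degree_pos_if_root[OF f(1,2)] f(1) by (simp add: is_unit_iff_degree)
    fix a b assume ab: "f = a * b"
    have "a dvd 1 \<or> b dvd 1" if "poly (map_poly to_ac a) x = 0" "f = a * b" for a b
    proof -
      have "a * b dvd a" using dvd[OF that(1)] that(2) by simp
      hence "b dvd 1" using f(1) that(2)
        by (metis dvd_mult_cancel_left mult.right_neutral mult_eq_0_iff)
      thus ?thesis ..
    qed
    moreover have "poly (map_poly to_ac a) x = 0 \<or> poly (map_poly to_ac b) x = 0"
      using f(2) by (simp add: ab map_poly_to_ac_mult)
    ultimately show "a dvd 1 \<or> b dvd 1"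
      using ab by (metis mult.commute)
  qed (use f in auto)
  thus ?thesis
    using that f(2) dvd by blast
qed

text \<open>
  Up to a unit, an irreducible polynomial is the minimal polynomial of each of its roots.
\<close>

lemma irreducible_dvd_if_common_root:
  assumes "irreducible f" "poly (map_poly to_ac f) x = 0" "poly (map_poly to_ac g) x = 0"
  shows "f dvd g"
proof -
  obtain m where m: "irreducible m" "m dvd f" "m dvd g"
    using min_poly_exists[of x] assms(2,3) by metis
  then obtain q where q: "f = m * q" by blast
  hence "q dvd 1"
    using assms(1) m(1) by (metis irreducible_def)
  hence "f dvd m"
    unfolding q by (simp add: mult_unit_dvd_iff)
  thus ?thesis
    using m(3) dvd_trans by blast
qed

text \<open>
  If the minimal polynomial \<open>f\<close> of \<open>z\<close> had derivative \<open>0\<close>, then \<open>h = f * q\<close> would have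
  \<open>h' = f * q'\<close>, which vanishes at \<open>z\<close>. So \<open>f'\<close> is a nonzero polynomial of smaller degree,
  and the irreducible \<open>f\<close> shares no root with it. Hence separability can be certified by any
  polynomial with a simple root at \<open>z\<close>.
\<close>

lemma sep_closureI:
  assumes h: "poly (map_poly to_ac h) z = 0" "poly (map_poly to_ac (pderiv h)) z \<noteq> 0"
  shows "z \<in> sep_closure"
proof -
  obtain f where f: "irreducible f" "poly (map_poly to_ac f) z = 0" "f dvd h"
    using min_poly_exists[of z] h(1) by metis
  then obtain q where q: "h = f * q" by blast
  have nz: "pderiv f \<noteq> 0"
    using h(2) f(2) by (auto simp: q pderiv_mult map_poly_to_ac_add map_poly_to_ac_mult)
  have ndvd: "\<not> f dvd pderiv f"
  proof
    assume "f dvd pderiv f"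
    hence "degree f \<le> degree (pderiv f)"
      using \<open>pderiv f \<noteq> 0\<close> by (rule dvd_imp_degree_le)
    hence "degree f = 0"
      using degree_pderiv_le[OF order_refl, of f] by linarith
    thus False using \<open>pderiv f \<noteq> 0\<close> by (metis degree_eq_zeroE pderiv_singleton)
  qed
  have "order u (map_poly to_ac f) \<le> 1" for u
  proof (rule ccontr)
    assume "\<not> order u (map_poly to_ac f) \<le> 1"
    hence "[:-u, 1:] ^ 2 dvd map_poly to_ac f"
      using power_le_dvd[OF order_1[of u "map_poly to_ac f"], of 2] by simp
    then obtain r where r: "map_poly to_ac f = [:-u, 1:] ^ 2 * r" by blast
    define l where "l = [:-u, 1:]"
    have l: "poly l u = 0" "map_poly to_ac f = l * (l * r)"
      using r by (simp add: l_def, simp only: l_def power2_eq_square mult.assoc)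
    have "poly (map_poly to_ac f) u = 0" "poly (map_poly to_ac (pderiv f)) u = 0"
      unfolding pderiv_map_poly_to_ac[symmetric] l(2) using l(1)
      by (simp_all add: pderiv_mult)
    thus False using irreducible_dvd_if_common_root[OF f(1)] ndvd by blast
  qed
  hence "rsquarefree (map_poly to_ac f)"
    using f(1) by (auto simp: rsquarefree_def le_Suc_eq)
  thus ?thesis
    using f unfolding sep_closure_def by blast
qed

lemma sep_closure_char_0:
  assumes "CHAR('a) = 0"
  shows "(x :: 'a::field alg_closure) \<in> sep_closure"
proof -
  obtain f where f: "irreducible f" "poly (map_poly to_ac f) x = 0"
    "\<And>g. poly (map_poly to_ac g) x = 0 \<Longrightarrow> f dvd g"
    using min_poly_exists[of x] by metis
  have "degree f > 0"
    using f(1) by (metis irreducible_def is_unit_iff_degree not_gr_zero)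
  hence "coeff (pderiv f) (degree f - 1) = of_nat (degree f) * lead_coeff f"
    by (simp add: coeff_pderiv)
  also have "\<dots> \<noteq> 0"
    using assms \<open>degree f > 0\<close> by (auto simp: of_nat_eq_0_iff_char_dvd)
  finally have "pderiv f \<noteq> 0"
    by auto
  moreover have "degree (pderiv f) < degree f"
    using degree_pderiv_le[OF order_refl, of f] \<open>degree f > 0\<close> by linarith
  ultimately have "\<not> f dvd pderiv f"
    by (meson dvd_imp_degree_le leD)
  hence "poly (map_poly to_ac (pderiv f)) x \<noteq> 0"
    using f(3) by blast
  with f(2) show ?thesis
    by (rule sep_closureI)
qed

text \<open>
  The algebraic closure as a vector space over the ground field. Separability is going to be
  expressed through dimensions of its finite-dimensional subspaces.
\<close>

interpretation ac: vector_space "\<lambda>a x. to_ac a * x"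
  by unfold_locales (simp_all add: algebra_simps)

lemma ac_span_mult:
  assumes "u \<in> ac.span A" "v \<in> ac.span B" "\<And>a b. a \<in> A \<Longrightarrow> b \<in> B \<Longrightarrow> a * b \<in> ac.span C"
  shows "u * v \<in> ac.span C"
  using assms(1)
proof (induction rule: ac.span_induct_alt)
  case (step c a u')
  have "a * v \<in> ac.span C"
    using assms(2)
  proof (induction rule: ac.span_induct_alt)
    case (step c b v')
    have "to_ac c * (a * b) + a * v' \<in> ac.span C"
      using step assms(3) \<open>a \<in> A\<close> by (intro ac.span_add ac.span_scale) auto
    thus ?case by (simp add: algebra_simps)
  qed (simp add: ac.span_zero)
  hence "to_ac c * (a * v) + u' * v \<in> ac.span C"
    using step by (intro ac.span_add ac.span_scale) auto
  thus ?case by (simp add: algebra_simps)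
qed (simp add: ac.span_zero)

lemma ac_span_power:
  assumes "u \<in> ac.span A" "1 \<in> ac.span A" "\<And>a b. a \<in> A \<Longrightarrow> b \<in> A \<Longrightarrow> a * b \<in> ac.span A"
  shows "u ^ n \<in> ac.span A"
  by (induction n) (use assms ac_span_mult[of _ A _ A A] in auto)

lemma ac_span_powers_power:
  assumes "u \<in> ac.span (range (\<lambda>i. v ^ i))"
  shows "u ^ n \<in> ac.span (range (\<lambda>i. v ^ i))"
  using assms
proof (rule ac_span_power)
  have "v ^ 0 \<in> ac.span (range (\<lambda>i. v ^ i))"
    by (intro ac.span_base) blast
  thus "1 \<in> ac.span (range (\<lambda>i. v ^ i))"
    by simp
qed (auto intro!: ac.span_base simp flip: power_add)

text \<open>
  A linear relation between the first \<open>n\<close> powers of \<open>x\<close> is a polynomial of degree less than \<open>n\<close>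
  that vanishes at \<open>x\<close>. The injectivity is part of the statement because independence of the
  image set alone does not see repeated powers.
\<close>

lemma powers_independent_iff:
  fixes x :: "'a::field alg_closure"
  shows "(inj_on (\<lambda>i. x ^ i) {..<n} \<and> ac.independent ((\<lambda>i. x ^ i) ` {..<n})) \<longleftrightarrow>
    (\<forall>g :: 'a poly. (\<forall>i\<ge>n. coeff g i = 0) \<and> poly (map_poly to_ac g) x = 0 \<longrightarrow> g = 0)"
    (is "?L \<longleftrightarrow> ?R")
proof
  assume L: ?L
  show ?R
  proof (intro allI impI)
    fix g :: "'a poly" assume g: "(\<forall>i\<ge>n. coeff g i = 0) \<and> poly (map_poly to_ac g) x = 0"
    define u where "u = (\<lambda>v. coeff g (inv_into {..<n} (\<lambda>i. x ^ i) v))"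
    have u: "u (x ^ i) = coeff g i" if "i < n" for i
      using L that by (simp add: u_def inv_into_f_f)
    have "(\<Sum>v\<in>(\<lambda>i. x ^ i) ` {..<n}. to_ac (u v) * v) = (\<Sum>i<n. to_ac (coeff g i) * x ^ i)"
      using L u by (subst sum.reindex) auto
    also have "\<dots> = 0"
      using g poly_map_poly_to_ac_lessThan[of n g x] by simp
    finally have "u (x ^ i) = 0" if "i < n" for i
      using ac.independentD[of "(\<lambda>i. x ^ i) ` {..<n}" "(\<lambda>i. x ^ i) ` {..<n}" u] L that by auto
    hence "coeff g i = 0" for i
      using u g by (metis not_le)
    thus "g = 0" by (simp add: poly_eqI)
  qed
next
  assume R: ?R
  have inj: "inj_on (\<lambda>i. x ^ i) {..<n}"
  proof (rule inj_onI)
    fix i j assume ij: "i \<in> {..<n}" "j \<in> {..<n}" "x ^ i = x ^ j"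
    have "poly (map_poly to_ac (monom 1 i + monom (-1) j)) x = 0"
      using ij(3) by (simp add: map_poly_to_ac_add map_poly_monom poly_monom)
    hence "monom 1 i + monom (-1) j = (0 :: 'a poly)"
      using R ij(1,2) by (auto simp: coeff_monom)
    hence "coeff (monom 1 i + monom (-1) j) i = (0 :: 'a)"
      by simp
    thus "i = j" by (auto split: if_splits)
  qed
  moreover have "ac.independent ((\<lambda>i. x ^ i) ` {..<n})"
  proof (rule ac.independent_if_scalars_zero)
    fix u :: "'a alg_closure \<Rightarrow> 'a" and v
    assume u: "(\<Sum>v\<in>(\<lambda>i. x ^ i) ` {..<n}. to_ac (u v) * v) = 0" and v: "v \<in> (\<lambda>i. x ^ i) ` {..<n}"
    define g where "g = Abs_poly (\<lambda>i. if i < n then u (x ^ i) else 0)"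
    have cg: "coeff g i = (if i < n then u (x ^ i) else 0)" for i
      unfolding g_def by (subst coeff_Abs_poly[of "n - 1"]) auto
    have "poly (map_poly to_ac g) x = (\<Sum>i<n. to_ac (u (x ^ i)) * x ^ i)"
      by (subst poly_map_poly_to_ac_lessThan[of n]) (auto simp: cg)
    also have "\<dots> = 0"
      using u inj by (subst (asm) sum.reindex) auto
    finally have "g = 0"
      using R cg by auto
    thus "u v = 0"
      using v cg by (metis (no_types, lifting) coeff_0 imageE lessThan_iff)
  qed auto
  ultimately show ?L ..
qed

lemma powers_in_span_low_powers:
  fixes f :: "'a::field poly"
  assumes "f \<noteq> 0" "poly (map_poly to_ac f) x = 0"
  shows "x ^ k \<in> ac.span ((\<lambda>i. x ^ i) ` {..<degree f})"
proof -
  have d: "degree f > 0"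
    using assms by (rule degree_pos_if_root)
  define g where "g = monom 1 k mod f"
  have "poly (map_poly to_ac (f * (monom 1 k div f) + g)) x = x ^ k"
    unfolding g_def by (simp add: map_poly_monom poly_monom)
  hence "x ^ k = poly (map_poly to_ac g) x"
    using assms(2) by (simp add: map_poly_to_ac_add map_poly_to_ac_mult)
  also have "\<dots> = (\<Sum>i<degree f. to_ac (coeff g i) * x ^ i)"
    using degree_mod_less[OF assms(1), of "monom 1 k"] d
    by (intro poly_map_poly_to_ac_lessThan) (auto simp: g_def coeff_eq_0)
  also have "\<dots> \<in> ac.span ((\<lambda>i. x ^ i) ` {..<degree f})"
    by (intro ac.span_sum ac.span_scale ac.span_base) auto
  finally show ?thesis .
qed


lemma CHAR_prime_alg_closure:
  assumes "CHAR('a::field) \<noteq> 0"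
  shows "prime CHAR('a alg_closure)"
  using prime_CHAR_semidom[where ?'a = 'a] assms by simp

lemma frobenius_add:
  fixes x y :: "'a::field alg_closure"
  assumes "CHAR('a) \<noteq> 0"
  shows "(x + y) ^ CHAR('a) = x ^ CHAR('a) + y ^ CHAR('a)"
  using freshmans_dream[OF CHAR_prime_alg_closure[OF assms]] by simp

lemma inj_frobenius:
  assumes "CHAR('a) \<noteq> 0"
  shows "inj (\<lambda>x :: 'a::field alg_closure. x ^ CHAR('a))"
proof (rule injI)
  fix x y :: "'a alg_closure" assume "x ^ CHAR('a) = y ^ CHAR('a)"
  moreover have "x ^ CHAR('a) = (x - y) ^ CHAR('a) + y ^ CHAR('a)"
    using frobenius_add[OF assms, of "x - y" y] by simp
  ultimately show "x = y"
    by simp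
qed

text \<open>
  The Frobenius map is not linear, but it sends a linear combination to a linear combination of
  the \<open>p\<close>-th powers.
\<close>

lemma frobenius_span:
  assumes "CHAR('a) \<noteq> 0" "u \<in> ac.span S"
  shows "u ^ CHAR('a) \<in> ac.span ((\<lambda>x :: 'a::field alg_closure. x ^ CHAR('a)) ` S)"
  using assms(2)
proof (induction rule: ac.span_induct_alt)
  case (step c x u)
  have "to_ac (c ^ CHAR('a)) * x ^ CHAR('a) + u ^ CHAR('a) \<in>
          ac.span ((\<lambda>x. x ^ CHAR('a)) ` S)"
    using step by (intro ac.span_add ac.span_scale) (auto intro: ac.span_base)
  thus ?case
    by (simp add: frobenius_add assms(1) power_mult_distrib)
next
  case base
  show ?case
    using assms(1) ac.span_zero by (simp add: power_0_left)
qed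

text \<open>
  Extend \<open>B\<close> to a basis of the span of \<open>S\<close>. The \<open>p\<close>-th powers of this basis span everything that
  the \<open>p\<close>-th powers of \<open>S\<close> span, hence at least the span of \<open>S\<close>. Being no more numerous than the
  dimension, they are independent.
\<close>

lemma frobenius_independent:
  fixes S B :: "'a::field alg_closure set"
  defines "F \<equiv> (\<lambda>x :: 'a alg_closure. x ^ CHAR('a))"
  assumes "CHAR('a) \<noteq> 0" "finite S" "S \<subseteq> ac.span (F ` S)" "B \<subseteq> ac.span S" "ac.independent B"
  shows "ac.independent (F ` B)"
proof -
  obtain B' where B': "B \<subseteq> B'" "B' \<subseteq> ac.span S" "ac.independent B'" "ac.span S \<subseteq> ac.span B'"
    using ac.maximal_independent_subset_extend[OF assms(5,6)] by metis
  have fin: "finite B'"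
    using ac.independent_span_bound[OF assms(3) B'(3,2)] by simp
  have "F ` S \<subseteq> ac.span (F ` B')"
    unfolding F_def using frobenius_span[OF assms(2)] B'(4) ac.span_base[of _ S] by blast
  hence "ac.span (F ` S) \<subseteq> ac.span (F ` B')"
    by (intro ac.span_minimal ac.subspace_span)
  hence "S \<subseteq> ac.span (F ` B')"
    using assms(4) by blast
  hence "ac.span S \<subseteq> ac.span (F ` B')"
    by (intro ac.span_minimal ac.subspace_span)
  hence sub: "B' \<subseteq> ac.span (F ` B')"
    using B'(2) by blast
  have "ac.independent (F ` B')"
  proof
    assume "ac.dependent (F ` B')"
    then obtain a where a: "a \<in> F ` B'" "a \<in> ac.span (F ` B' - {a})"
      unfolding ac.dependent_def by blast
    hence "ac.span (F ` B') = ac.span (F ` B' - {a})"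
      by (metis ac.span_redundant insert_Diff)
    with sub have "card B' \<le> card (F ` B' - {a})"
      using ac.independent_span_bound[OF _ B'(3)] fin by simp
    also have "\<dots> < card (F ` B')"
      using a(1) fin by (intro psubset_card_mono) auto
    also have "\<dots> \<le> card B'"
      using fin by (rule card_image_le)
    finally show False by simp
  qed
  thus ?thesis
    using B'(1) by (rule ac.independent_mono[OF _ image_mono])
qed

text \<open>
  The first \<open>degree f\<close> powers of \<open>x\<close> span a space that is closed under multiplication by \<open>x\<close>. If
  the same number of powers of \<open>x ^ p\<close> are independent, they span this space too.
\<close>

lemma in_span_frobenius_powers:
  fixes x :: "'a::field alg_closure" and f :: "'a poly"
  assumes "f \<noteq> 0" "poly (map_poly to_ac f) x = 0"
    and "inj_on (\<lambda>i. (x ^ CHAR('a)) ^ i) {..<degree f}"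
    and "ac.independent ((\<lambda>i. (x ^ CHAR('a)) ^ i) ` {..<degree f})"
  shows "x \<in> ac.span (range (\<lambda>i. (x ^ CHAR('a)) ^ i))"
proof -
  let ?A = "(\<lambda>i. (x ^ CHAR('a)) ^ i) ` {..<degree f}" and ?T = "(\<lambda>i. x ^ i) ` {..<degree f}"
  have pow: "x ^ k \<in> ac.span ?T" for k
    using assms(1,2) by (rule powers_in_span_low_powers)
  have "x \<in> ac.span ?A"
  proof (rule ccontr)
    assume nin: "x \<notin> ac.span ?A"
    hence ind: "ac.independent (insert x ?A)"
      using assms(4) by (rule ac.independent_insertI)
    have "insert x ?A \<subseteq> ac.span ?T"
      using pow pow[of 1] by (auto simp flip: power_mult)
    with ind have "card (insert x ?A) \<le> card ?T"
      using ac.independent_span_bound[of ?T] by simp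
    also have "card ?T \<le> degree f"
      using card_image_le[of "{..<degree f}"] by simp
    also have "degree f = card ?A"
      using assms(3) by (simp add: card_image)
    finally show False
      using nin ac.span_base[of x ?A] by (cases "x \<in> ?A") auto
  qed
  thus ?thesis
    using ac.span_mono[of ?A "range (\<lambda>i. (x ^ CHAR('a)) ^ i)"] by blast
qed

lemma span_powers_imp_poly:
  assumes "u \<in> ac.span (range (\<lambda>i. x ^ i))"
  shows "\<exists>g. u = poly (map_poly to_ac g) x"
  using assms
proof (induction rule: ac.span_induct_alt)
  case base
  show ?case by (rule exI[of _ 0]) simp
next
  case (step c y u)
  then obtain g i where "u = poly (map_poly to_ac g) x" "y = x ^ i" by blast
  hence "to_ac c * y + u = poly (map_poly to_ac (monom c i + g)) x"
    by (simp add: map_poly_to_ac_add map_poly_monom poly_monom)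
  thus ?case ..
qed

text \<open>
  An element is separable if and only if it is a polynomial in its \<open>p\<close>-th power: if
  \<open>x = g (x ^ p)\<close>, then \<open>T - g (T ^ p)\<close> has derivative 1 and vanishes at \<open>x\<close>. Conversely, if the
  minimal polynomial \<open>f\<close> has \<open>degree f\<close> distinct roots, so do their \<open>p\<close>-th powers, which leaves no
  room for a polynomial of smaller degree vanishing at \<open>x ^ p\<close>.
\<close>

lemma sep_closure_iff_frobenius:
  fixes x :: "'a::field alg_closure"
  assumes "CHAR('a) \<noteq> 0"
  shows "x \<in> sep_closure \<longleftrightarrow> x \<in> ac.span (range (\<lambda>i. (x ^ CHAR('a)) ^ i))"
proof
  assume "x \<in> ac.span (range (\<lambda>i. (x ^ CHAR('a)) ^ i))"
  then obtain g :: "'a poly" where g: "x = poly (map_poly to_ac g) (x ^ CHAR('a))"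
    using span_powers_imp_poly by blast
  define h where "h = [:0, 1:] - pcompose g (monom 1 (CHAR('a)))"
  have "poly (map_poly to_ac h) x = 0"
    using g by (simp add: h_def map_poly_to_ac_diff map_poly_to_ac_pcompose poly_pcompose map_poly_monom poly_monom map_poly_pCons)
  moreover have "pderiv h = 1"
    by (simp add: h_def pderiv_diff pderiv_pcompose pderiv_monom pderiv_pCons)
  ultimately show "x \<in> sep_closure"
    by (intro sep_closureI[of h]) simp_all
next
  assume "x \<in> sep_closure"
  then obtain f where f: "irreducible f" "rsquarefree (map_poly to_ac f)"
      "poly (map_poly to_ac f) x = 0"
    by (auto simp: sep_closure_def)
  have nz: "f \<noteq> 0"
    using f(1) by auto
  define r where "r = proots (map_poly to_ac f)"
  have count: "count r u = (if poly (map_poly to_ac f) u = 0 then 1 else 0)" for u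
    using f(2) nz unfolding r_def
    by (cases "poly (map_poly to_ac f) u = 0") (force simp: rsquarefree_def order_root)+
  obtain A where A: "size A = degree (map_poly to_ac f)"
    "map_poly to_ac f = smult (lead_coeff (map_poly to_ac f)) (\<Prod>x\<in>#A. [:-x, 1:])"
    using alg_closed_imp_factorization[of "map_poly to_ac f"] nz by auto
  have "r = A"
  proof -
    have "proots (\<Prod>x\<in>#A. [:-x, 1:]) = A" 
    proof (induction A)
      case (add x A)
      have "proots ([:-x, 1:] * (\<Prod>x\<in>#A. [:-x, 1:])) =
              proots [:-x, 1:] + proots (\<Prod>x\<in>#A. [:-x, 1:])"
        by (rule proots_mult) (auto simp: prod_mset_zero_iff)
      thus ?case
        using add by simp
    qed simp
    thus ?thesis unfolding r_def using A(2) nz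
      by (metis proots_smult leading_coeff_0_iff map_poly_to_ac_eq_0_iff)
  qed
  hence "size r = degree f" using A(1) by simp
  moreover have "mset_set (set_mset r) = r"
    by (rule multiset_eqI) (use count in \<open>auto simp: count_mset_set' simp flip: count_greater_zero_iff\<close>)
  ultimately have card: "card {u. poly (map_poly to_ac f) u = 0} = degree f"
    using nz by (metis map_poly_to_ac_eq_0_iff r_def set_count_proots size_mset_set)
  have "g = 0" if g: "\<forall>i\<ge>degree f. coeff g i = 0" "poly (map_poly to_ac g) (x ^ CHAR('a)) = 0"
    for g :: "'a poly"
  proof (rule ccontr)
    assume "g \<noteq> 0"
    have "f dvd pcompose g (monom 1 (CHAR('a)))"
      using irreducible_dvd_if_common_root[OF f(1,3)] g(2)
      by (simp add: map_poly_to_ac_pcompose poly_pcompose map_poly_monom poly_monom)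
    then obtain q where q: "pcompose g (monom 1 (CHAR('a))) = f * q" by blast
    have root: "poly (map_poly to_ac g) (u ^ CHAR('a)) = 0"
      if "poly (map_poly to_ac f) u = 0" for u
    proof -
      have "poly (map_poly to_ac g) (u ^ CHAR('a)) =
              poly (map_poly to_ac (pcompose g (monom 1 (CHAR('a))))) u"
        by (simp add: map_poly_to_ac_pcompose poly_pcompose map_poly_monom poly_monom)
      thus ?thesis
        using that by (simp add: q map_poly_to_ac_mult)
    qed
    have "degree f = card ((\<lambda>u. u ^ CHAR('a)) ` {u. poly (map_poly to_ac f) u = 0})"
      using inj_frobenius[OF assms] card by (metis card_image inj_on_subset top_greatest)
    also have "\<dots> \<le> card {v. poly (map_poly to_ac g) v = 0}"
      using root \<open>g \<noteq> 0\<close> by (intro card_mono poly_roots_finite) auto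
    also have "\<dots> \<le> degree g"
      using \<open>g \<noteq> 0\<close> by (metis card_poly_roots_bound degree_map_poly_to_ac map_poly_to_ac_eq_0_iff)
    also have "degree g < degree f"
      using \<open>g \<noteq> 0\<close> g(1) by (metis leading_coeff_0_iff not_le)
    finally show False by simp
  qed
  thus "x \<in> ac.span (range (\<lambda>i. (x ^ CHAR('a)) ^ i))"
    using in_span_frobenius_powers[OF nz f(3)] powers_independent_iff[of "x ^ CHAR('a)" "degree f"]
    by blast
qed


text \<open>
  The algebra generated by two separable elements is contained in the span of its own \<open>p\<close>-th
  powers, because each generator is. The Frobenius map therefore preserves linear independence in
  it, and applying this to the powers of \<open>z\<close> shows that \<open>z\<close> is a polynomial in \<open>z ^ p\<close>.
\<close>

lemma sep_closure_subalgebra: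
  fixes x y z :: "'a::field alg_closure"
  assumes "x \<in> sep_closure" "y \<in> sep_closure"
    and z: "z \<in> ac.span ({x ^ i * y ^ j | i j. True})"
  shows "z \<in> sep_closure"
proof (cases "CHAR('a) = 0")
  case False
  define F where "F = (\<lambda>x :: 'a alg_closure. x ^ CHAR('a))"
  define T where "T = {x ^ i * y ^ j | i j. True}"
  obtain f g where f: "f \<noteq> 0" "poly (map_poly to_ac f) x = 0"
    and g: "g \<noteq> 0" "poly (map_poly to_ac g) y = 0"
    using alg_closure_algebraic by metis
  define S where "S = (\<lambda>(i, j). x ^ i * y ^ j) ` ({..<degree f} \<times> {..<degree g})"
  have fin: "finite S"
    by (simp add: S_def)
  have T_S: "T \<subseteq> ac.span S"
  proof -
    have "x ^ i * y ^ j \<in> ac.span S" for i j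
      using powers_in_span_low_powers[OF f] powers_in_span_low_powers[OF g]
      by (rule ac_span_mult) (auto simp: S_def intro!: ac.span_base)
    thus ?thesis by (auto simp: T_def)
  qed
  have F_T: "F ` T \<subseteq> ac.span (F ` S)"
    using T_S frobenius_span[OF False] by (auto simp: F_def)
  have F_mult: "F (u * v) = F u * F v" and F_power: "F (u ^ i) = F u ^ i" for u v i
    by (simp_all add: F_def power_mult_distrib flip: power_mult) (simp add: mult.commute)
  have "x ^ i * y ^ j \<in> ac.span (F ` S)" for i j
  proof -
    have x: "x ^ i \<in> ac.span (range (\<lambda>i. F x ^ i))" for i
      using assms(1) unfolding sep_closure_iff_frobenius[OF False] F_def
      by (rule ac_span_powers_power)
    have y: "y ^ i \<in> ac.span (range (\<lambda>i. F y ^ i))" for i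
      using assms(2) unfolding sep_closure_iff_frobenius[OF False] F_def
      by (rule ac_span_powers_power)
    have "F x ^ i * F y ^ j \<in> ac.span (F ` S)" for i j
    proof -
      have "F (x ^ i * y ^ j) \<in> F ` T" by (auto simp: T_def)
      thus ?thesis using F_T by (auto simp: F_mult F_power)
    qed
    thus ?thesis
      by (intro ac_span_mult[OF x y]) auto
  qed
  hence S_F: "S \<subseteq> ac.span (F ` S)"
    by (auto simp: S_def)
  have T_mult: "a * b \<in> ac.span T" if ab: "a \<in> T" "b \<in> T" for a b
  proof -
    obtain i j i' j' where "a = x ^ i * y ^ j" "b = x ^ i' * y ^ j'"
      using ab unfolding T_def by blast
    hence "a * b = x ^ (i + i') * y ^ (j + j')"
      by (simp add: power_add mult_ac)
    thus ?thesis by (auto simp: T_def intro!: ac.span_base)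
  qed
  have "1 \<in> T"
    unfolding T_def by (rule CollectI, intro exI[of _ 0]) simp
  hence "z ^ i \<in> ac.span T" for i
    using z T_mult unfolding T_def[symmetric] by (intro ac_span_power) (auto intro: ac.span_base)
  moreover have "ac.span T \<subseteq> ac.span S"
    using T_S by (intro ac.span_minimal ac.subspace_span)
  ultimately have zS: "z ^ i \<in> ac.span S" for i
    by blast
  obtain h where h: "irreducible h" "poly (map_poly to_ac h) z = 0"
    "\<And>g. poly (map_poly to_ac g) z = 0 \<Longrightarrow> h dvd g"
    using min_poly_exists[of z] by metis
  have "g = 0" if "\<forall>i\<ge>degree h. coeff g i = 0" "poly (map_poly to_ac g) z = 0" for g
  proof (rule ccontr)
    assume "g \<noteq> 0"
    hence "degree h \<le> degree g"
      using h(3)[OF that(2)] by (simp add: dvd_imp_degree_le)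
    thus False
      using that(1) \<open>g \<noteq> 0\<close> by (metis leading_coeff_0_iff)
  qed
  hence ind: "inj_on (\<lambda>i. z ^ i) {..<degree h}" "ac.independent ((\<lambda>i. z ^ i) ` {..<degree h})"
    using powers_independent_iff[of z "degree h"] by blast+
  have "ac.independent (F ` (\<lambda>i. z ^ i) ` {..<degree h})"
    unfolding F_def
    by (rule frobenius_independent[OF False fin])
      (use S_F zS ind(2) in \<open>auto simp: F_def\<close>)
  moreover have "F (z ^ i) = F z ^ i" for i
    by (rule F_power)
  moreover have "inj_on (\<lambda>i. F (z ^ i)) {..<degree h}"
    using ind(1) inj_frobenius[OF False] unfolding F_def inj_on_def by blast
  ultimately have "z \<in> ac.span (range (\<lambda>i. (z ^ CHAR('a)) ^ i))"
    using h(1,2) by (intro in_span_frobenius_powers[of h]) (auto simp: F_def image_image)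
  thus ?thesis
    by (simp add: sep_closure_iff_frobenius[OF False])
qed (rule sep_closure_char_0)

lemma sep_closure_mult:
  assumes "x \<in> sep_closure" "y \<in> sep_closure"
  shows "x * y \<in> sep_closure"
  using assms
proof (rule sep_closure_subalgebra)
  have "x ^ 1 * y ^ 1 \<in> ac.span {x ^ i * y ^ j | i j. True}"
    by (intro ac.span_base) blast
  thus "x * y \<in> ac.span {x ^ i * y ^ j | i j. True}"
    by simp
qed

lemma sep_closure_add:
  assumes "x \<in> sep_closure" "y \<in> sep_closure"
  shows "x + y \<in> sep_closure"
  using assms
proof (rule sep_closure_subalgebra)
  have "x ^ 1 * y ^ 0 \<in> ac.span {x ^ i * y ^ j | i j. True}"
       "x ^ 0 * y ^ 1 \<in> ac.span {x ^ i * y ^ j | i j. True}"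
    by (intro ac.span_base; blast)+
  hence "x ^ 1 * y ^ 0 + x ^ 0 * y ^ 1 \<in> ac.span {x ^ i * y ^ j | i j. True}"
    by (rule ac.span_add)
  thus "x + y \<in> ac.span {x ^ i * y ^ j | i j. True}"
    by simp
qed


section \<open>Binary forms on the projective line\<close>

text \<open>
  The determinant of two points of the projective line in the coordinates \<open>(a, 1)\<close> for
  \<^term>\<open>Fin a\<close> and \<open>(1, 0)\<close> for \<^term>\<open>Infty\<close>. It replaces the difference of two affine
  coordinates, so that the point at infinity needs no special treatment.
\<close>

fun wedge :: "'k::field proj_line \<Rightarrow> 'k proj_line \<Rightarrow> 'k" where
  "wedge (Fin a) (Fin b) = a - b"
| "wedge Infty (Fin b) = 1"
| "wedge (Fin a) Infty = -1"
| "wedge Infty Infty = 0"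

text \<open>
  A polynomial of degree at most \<open>m\<close> is read as a binary form of degree \<open>m\<close>, and evaluated at the
  same coordinates.
\<close>

fun form_eval :: "nat \<Rightarrow> 'k::field poly \<Rightarrow> 'k proj_line \<Rightarrow> 'k" where
  "form_eval m p (Fin a) = poly p a"
| "form_eval m p Infty = coeff p m"

text \<open>
  The linear form with zero \<open>z\<close>, scaled so that its value at \<open>x\<close> is \<^term>\<open>wedge x z\<close>.
\<close>

fun lin :: "'k::field proj_line \<Rightarrow> 'k poly" where
  "lin (Fin a) = [:-a, 1:]"
| "lin Infty = [:-1:]"

lemma wedge_eq_0_iff [simp]: "wedge x y = 0 \<longleftrightarrow> x = y"
  by (cases x; cases y) auto

lemma wedge_commute: "wedge y x = - wedge x y"
  by (cases x; cases y) auto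

lemma form_eval_lin [simp]: "form_eval 1 (lin z) x = wedge x z" "form_eval (Suc 0) (lin z) x = wedge x z"
  by (cases x; cases z; simp)+

lemma degree_lin: "degree (lin z) \<le> 1"
  by (cases z) auto

lemma lin_nonzero [simp]: "lin z \<noteq> 0"
  by (cases z) auto

lemma form_eval_1 [simp]: "form_eval 0 1 x = 1"
  by (cases x) auto

lemma form_eval_diff: "form_eval m (p - q) x = form_eval m p x - form_eval m q x"
  by (cases x) auto

lemma form_eval_smult: "form_eval m (smult c p) x = c * form_eval m p x"
  by (cases x) auto

text \<open>
  The value at infinity of a product of two forms.
\<close>

lemma coeff_mult_top:
  fixes p q :: "'k::idom poly"
  assumes "degree p \<le> m" "degree q \<le> n"
  shows "coeff (p * q) (m + n) = coeff p m * coeff q n"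
proof -
  have "coeff (p * q) (m + n) = (\<Sum>i\<le>m + n. if i = m then coeff p m * coeff q n else 0)"
    unfolding coeff_mult
  proof (intro sum.cong refl)
    fix i assume "i \<in> {..m + n}"
    thus "coeff p i * coeff q (m + n - i) = (if i = m then coeff p m * coeff q n else 0)"
      using assms by (cases i m rule: linorder_cases) (auto simp: coeff_eq_0)
  qed
  thus ?thesis by simp
qed

lemma form_eval_mult:
  assumes "degree p \<le> m" "degree q \<le> n"
  shows "form_eval (m + n) (p * q) x = form_eval m p x * form_eval n q x"
  using coeff_mult_top[OF assms] by (cases x) auto

lemma form_eval_prod_lin:
  assumes "finite Z"
  shows "degree (\<Prod>z\<in>Z. lin z) \<le> card Z"
    and "form_eval (card Z) (\<Prod>z\<in>Z. lin z) x = (\<Prod>z\<in>Z. wedge x z)"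
proof -
  have "degree (\<Prod>z\<in>Z. lin z) \<le> card Z \<and>
        form_eval (card Z) (\<Prod>z\<in>Z. lin z) x = (\<Prod>z\<in>Z. wedge x z)"
    using assms
  proof induction
    case (insert z Z)
    have "degree (lin z * prod lin Z) \<le> 1 + card Z"
      using degree_mult_le[of "lin z" "prod lin Z"] degree_lin[of z] insert by linarith
    moreover have "form_eval (1 + card Z) (lin z * prod lin Z) x = wedge x z * (\<Prod>z\<in>Z. wedge x z)"
      using form_eval_mult[OF degree_lin] insert by (metis form_eval_lin(1))
    ultimately show ?case
      using insert by simp
  qed simp
  thus "degree (\<Prod>z\<in>Z. lin z) \<le> card Z"
    "form_eval (card Z) (\<Prod>z\<in>Z. lin z) x = (\<Prod>z\<in>Z. wedge x z)" by simp_all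
qed

lemma form_eval_prod_mset_lin:
  shows "form_eval (size Z) (\<Prod>z\<in>#Z. lin z) x = (\<Prod>z\<in>#Z. wedge x z)"
proof -
  have "degree (\<Prod>z\<in>#Z. lin z) \<le> size Z \<and>
        form_eval (size Z) (\<Prod>z\<in>#Z. lin z) x = (\<Prod>z\<in>#Z. wedge x z)"
  proof (induction Z)
    case (add z Z)
    have "degree (lin z * (\<Prod>z\<in>#Z. lin z)) \<le> 1 + size Z"
      using degree_mult_le[of "lin z" "\<Prod>z\<in>#Z. lin z"] degree_lin[of z] add by linarith
    moreover have "form_eval (1 + size Z) (lin z * (\<Prod>z\<in>#Z. lin z)) x
        = wedge x z * (\<Prod>z\<in>#Z. wedge x z)"
      using form_eval_mult[OF degree_lin] add by (metis form_eval_lin(1))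
    ultimately show ?case
      using add by simp
  qed simp
  thus ?thesis by simp
qed

lemma form_divide_lin:
  assumes "degree p \<le> Suc m" "form_eval (Suc m) p z = 0"
  obtains g where "p = lin z * g" "degree g \<le> m"
proof (cases z)
  case (Fin a)
  with assms(2) obtain g where g: "p = [:-a, 1:] * g"
    by (auto simp: poly_eq_0_iff_dvd)
  have "degree g \<le> m"
  proof (cases "g = 0")
    case False
    hence "degree p = 1 + degree g"
      unfolding g by (subst degree_mult_eq) auto
    thus ?thesis using assms(1) by simp
  qed simp
  thus ?thesis using that g Fin by simp
next
  case Infty
  hence "coeff p (Suc m) = 0"
    using assms(2) by simp
  hence "degree p \<le> m"
    using assms(1) by (metis degree_0 le_SucE leading_coeff_0_iff zero_le)
  thus ?thesis
    using that[of "- p"] Infty by simp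
qed

text \<open>
  A form of degree \<open>n\<close> with \<open>n\<close> distinct zeros is determined up to a scalar. The scalar may be
  \<open>0\<close> here.
\<close>

lemma form_factor:
  assumes "finite Z" "degree p \<le> card Z" "\<And>z. z \<in> Z \<Longrightarrow> form_eval (card Z) p z = 0"
  obtains c where "p = smult c (\<Prod>z\<in>Z. lin z)"
proof -
  have "\<exists>c. p = smult c (\<Prod>z\<in>Z. lin z)"
    using assms
  proof (induction Z arbitrary: p)
    case empty
    thus ?case by (auto elim!: degree_eq_zeroE)
  next
    case (insert z Z)
    obtain g where g: "p = lin z * g" "degree g \<le> card Z"
      using form_divide_lin[of p "card Z" z] insert by auto
    have "form_eval (card Z) g x = 0" if "x \<in> Z" for x
    proof -
      have "wedge x z * form_eval (card Z) g x = 0"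
        using form_eval_mult[OF degree_lin g(2), of z x] insert.prems(2)[of x] insert.hyps that
        by (simp add: g(1))
      thus ?thesis using insert.hyps that by auto
    qed
    then obtain c where "g = smult c (\<Prod>z\<in>Z. lin z)"
      using insert.IH g(2) by blast
    thus ?case
      using insert.hyps g(1) by auto
  qed
  thus ?thesis using that by blast
qed

text \<open>
  The drop of the degree of \<open>p\<close> below \<open>m\<close> is the multiplicity of the zero at infinity.
\<close>

lemma form_splits:
  fixes p :: "'k::alg_closed_field poly"
  assumes "p \<noteq> 0" "degree p \<le> m"
  obtains w C where "w \<noteq> 0" "size C = m" "p = smult w (\<Prod>c\<in>#C. lin c)"
proof -
  obtain A where A: "size A = degree p" "p = smult (lead_coeff p) (\<Prod>x\<in>#A. [:-x, 1:])"
    using alg_closed_imp_factorization[OF assms(1)] by blast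
  define e where "e = m - degree p"
  define C where "C = image_mset Fin A + replicate_mset e Infty"
  have "(\<Prod>c\<in>#C. lin c) = (\<Prod>x\<in>#A. [:-x, 1:]) * [:-1:] ^ e"
    by (simp add: C_def image_mset.compositionality o_def)
  also have "[:-1:] ^ e = [:(-1 :: 'k) ^ e:]"
    by (induction e) simp_all
  finally have "(\<Prod>c\<in>#C. lin c) = smult ((-1) ^ e) (\<Prod>x\<in>#A. [:-x, 1:])"
    by simp
  hence "p = smult (lead_coeff p * (-1) ^ e) (\<Prod>c\<in>#C. lin c)"
    using A(2) by (simp add: mult.assoc flip: power_mult_distrib)
  moreover have "size C = m"
    using assms(2) A(1) by (simp add: C_def e_def)
  ultimately show ?thesis
    using that assms(1) by (metis leading_coeff_0_iff mult_eq_0_iff power_eq_0_iff neg_equal_0_iff_equal one_neq_zero)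
qed


section \<open>Fibres and Wronskian of a rational map\<close>

lemma coeff_mult_below_top:
  fixes p q :: "'k::idom poly"
  assumes "degree p \<le> Suc m" "degree q \<le> Suc n"
  shows "coeff (p * q) (Suc (m + n)) = coeff p (Suc m) * coeff q n + coeff p m * coeff q (Suc n)"
proof -
  have "coeff (p * q) (Suc (m + n)) =
    (\<Sum>i\<le>Suc (m + n). (if i = Suc m then coeff p (Suc m) * coeff q n else 0) +
       (if i = m then coeff p m * coeff q (Suc n) else 0))"
    unfolding coeff_mult
  proof (intro sum.cong refl)
    fix i assume i: "i \<in> {..Suc (m + n)}"
    consider "i < m" | "i = m" | "i = Suc m" | "i > Suc m" by linarith
    thus "coeff p i * coeff q (Suc (m + n) - i) =
      (if i = Suc m then coeff p (Suc m) * coeff q n else 0) +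
      (if i = m then coeff p m * coeff q (Suc n) else 0)"
      using assms i by cases (auto simp: coeff_eq_0 Suc_diff_le)
  qed
  thus ?thesis by (simp add: sum.distrib)
qed

lemma prod_lin_lead_coeff:
  assumes "finite Z"
  shows "lead_coeff (\<Prod>z\<in>Z. lin z :: 'k::field poly) = (if Infty \<in> Z then -1 else 1)"
proof -
  have *: "lead_coeff (lin z) = (if Infty = z then -1 else 1)" for z :: "'k proj_line"
    by (cases z) auto
  have "lead_coeff (\<Prod>z\<in>Z. lin z :: 'k poly) = (\<Prod>z\<in>Z. lead_coeff (lin z))"
    by (rule lead_coeff_prod)
  also have "\<dots> = (\<Prod>z\<in>Z. if Infty = z then -1 else 1)"
    by (simp only: *)
  finally show ?thesis
    using assms by (simp add: prod.delta)
qed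

text \<open>
  Each \<open>y\<close> is the second component of exactly \<open>card Y - 1\<close> ordered pairs of distinct elements.
\<close>

lemma prod_pairs_snd:
  assumes "finite Y"
  shows "(\<Prod>y\<in>Y. \<Prod>z\<in>Y - {y}. f z) = (\<Prod>y\<in>Y. f y :: 'b::comm_semiring_1) ^ (card Y - 1)"
proof -
  have "(\<Prod>y\<in>Y. \<Prod>z\<in>Y - {y}. f z) = (\<Prod>y\<in>Y. \<Prod>z | z \<in> Y \<and> z \<noteq> y. f z)"
    by (intro prod.cong) auto
  also have "\<dots> = (\<Prod>z\<in>Y. \<Prod>y | y \<in> Y \<and> z \<noteq> y. f z)"
    using assms by (intro prod.swap_restrict) auto
  also have "\<dots> = (\<Prod>z\<in>Y. f z ^ (card Y - 1))"
  proof (intro prod.cong refl)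
    fix z assume "z \<in> Y"
    hence "{y. y \<in> Y \<and> z \<noteq> y} = Y - {z}" "card (Y - {z}) = card Y - 1"
      using assms by auto
    thus "(\<Prod>y | y \<in> Y \<and> z \<noteq> y. f z) = f z ^ (card Y - 1)"
      by simp
  qed
  also have "\<dots> = (\<Prod>y\<in>Y. f y) ^ (card Y - 1)"
    by (rule prod_power_distrib[symmetric])
  finally show ?thesis .
qed

locale rational_map =
  fixes d :: nat and P Q :: "'k::alg_closed_field poly"
  assumes degree_P: "degree P \<le> d" and degree_Q: "degree Q \<le> d" and d_ge_2: "d \<ge> 2"
    and no_common_zero: "form_eval d P x \<noteq> 0 \<or> form_eval d Q x \<noteq> 0"
begin

definition rmap :: "'k proj_line \<Rightarrow> 'k proj_line" where
  "rmap x = (if form_eval d Q x = 0 then Infty else Fin (form_eval d P x / form_eval d Q x))"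

text \<open>
  If \<open>X\<close> denotes the coordinates of \<open>x\<close>, then \<open>(P X, Q X)\<close> is this factor times the
  coordinates of \<^term>\<open>rmap x\<close>.
\<close>

definition lift_factor :: "'k proj_line \<Rightarrow> 'k" where
  "lift_factor x = (if form_eval d Q x = 0 then form_eval d P x else form_eval d Q x)"

text \<open>
  The wedge of \<open>(P, Q)\<close> with the coordinates of \<open>y\<close>, a form of degree \<open>d\<close>.
\<close>

definition fib_form :: "'k proj_line \<Rightarrow> 'k poly" where
  "fib_form y = (case y of Fin b \<Rightarrow> P - smult b Q | Infty \<Rightarrow> - Q)"

definition fib :: "'k proj_line \<Rightarrow> 'k proj_line set" where
  "fib y = {x. rmap x = y}"

text \<open>
  This is read as a form of degree \<open>2 * d - 2\<close>. The Jacobian determinant of the pair of forms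
  \<open>(P, Q)\<close> is \<open>d\<close> times this form, whose zeros are the critical points.
\<close>

definition wronskian :: "'k poly" where
  "wronskian = pderiv P * Q - P * pderiv Q"

text \<open>
  The scalar in the factorisation of \<open>fib_form y\<close> into the forms \<open>lin z\<close>. The sign accounts for
  \<^term>\<open>lin Infty\<close>, which is the constant \<open>-1\<close>.
\<close>

definition fib_lead :: "'k proj_line \<Rightarrow> 'k" where
  "fib_lead y = lead_coeff (fib_form y) * (if Infty \<in> fib y then -1 else 1)"

definition fib_lift_factor :: "'k proj_line \<Rightarrow> 'k" where
  "fib_lift_factor y = (\<Prod>x\<in>fib y. lift_factor x)"

lemma lift_factor_nonzero [simp]: "lift_factor x \<noteq> 0"
  using no_common_zero[of x] by (auto simp: lift_factor_def)

lemma degree_fib_form: "degree (fib_form y) \<le> d"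
  using degree_P degree_Q
  by (auto simp: fib_form_def split: proj_line.splits
      intro!: degree_diff_le order_trans[OF degree_smult_le])

lemma form_eval_uminus: "form_eval m (- p) x = - form_eval m p x"
  by (cases x) auto

lemma fib_form_eval: "form_eval d (fib_form y) x = lift_factor x * wedge (rmap x) y"
proof (cases "form_eval d Q x = 0")
  case True
  thus ?thesis
    by (cases y) (simp_all add: fib_form_def lift_factor_def rmap_def form_eval_diff form_eval_smult
      form_eval_uminus)
next
  case False
  thus ?thesis
    by (cases y) (simp_all add: fib_form_def lift_factor_def rmap_def form_eval_diff form_eval_smult
      form_eval_uminus field_simps)
qed

lemma fib_iff: "x \<in> fib y \<longleftrightarrow> form_eval d (fib_form y) x = 0"
  by (auto simp: fib_def fib_form_eval)

lemma form_has_zero: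
  fixes p :: "'k poly"
  assumes "degree p \<le> d"
  shows "\<exists>x. form_eval d p x = 0"
proof (cases "p = 0")
  case True
  have "form_eval d p Infty = 0"
    using True by simp
  thus ?thesis ..
next
  case False
  then obtain w C where C: "size C = d" "p = smult w (\<Prod>c\<in>#C. lin c)"
    using form_splits[OF _ assms] by metis
  then obtain x where "x \<in># C"
    using d_ge_2 by (metis not_numeral_le_zero multiset_nonemptyE size_empty)
  hence "form_eval d p x = 0"
    unfolding C(2) form_eval_smult C(1)[symmetric] form_eval_prod_mset_lin
    by (auto simp: prod_mset_zero_iff)
  thus ?thesis ..
qed

text \<open>
  Otherwise \<open>rmap\<close> would be constant. But \<open>P\<close> and \<open>Q\<close> both have zeros, and these are mapped to
  different points.
\<close>

lemma fib_form_nonzero: "fib_form y \<noteq> 0"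
proof
  assume "fib_form y = 0"
  hence *: "rmap x = y" for x
    using fib_form_eval[of y x] by (cases x) auto
  obtain x x' where x: "form_eval d P x = 0" "form_eval d Q x' = 0"
    using form_has_zero degree_P degree_Q by metis
  have "rmap x \<noteq> Infty"
    using no_common_zero[of x] x by (auto simp: rmap_def)
  moreover have "rmap x' = Infty"
    using x by (auto simp: rmap_def)
  ultimately show False
    using * by metis
qed

lemma finite_fib [simp]: "finite (fib y)" and card_fib_le: "card (fib y) \<le> d"
proof -
  obtain w C where C: "w \<noteq> 0" "size C = d" "fib_form y = smult w (\<Prod>c\<in>#C. lin c)"
    using form_splits[OF fib_form_nonzero degree_fib_form] by metis
  have "form_eval d (\<Prod>c\<in>#C. lin c) x = (\<Prod>c\<in>#C. wedge x c)" for x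
    using form_eval_prod_mset_lin[of C x] C(2) by simp
  hence "fib y = set_mset C"
    using C(1) by (auto simp: fib_iff C(3) form_eval_smult prod_mset_zero_iff)
  moreover have "card (set_mset C) \<le> size C"
    by (metis size_multiset_overloaded_eq size_mset_set mset_set_set_mset_msubset size_mset_mono)
  ultimately show "finite (fib y)" "card (fib y) \<le> d"
    using C(2) by auto
qed

text \<open>
  An unramified fibre gives all zeros of its form, so the form can be rebuilt from them.
\<close>

lemma fib_factor:
  assumes "card (fib y) = d"
  shows "fib_form y = smult (fib_lead y) (\<Prod>z\<in>fib y. lin z)"
    and "fib_lead y \<noteq> 0"
    and "lift_factor x * wedge (rmap x) y = fib_lead y * (\<Prod>z\<in>fib y. wedge x z)"
proof -
  obtain c where c: "fib_form y = smult c (\<Prod>z\<in>fib y. lin z)"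
  proof (rule form_factor)
    show "finite (fib y)" "degree (fib_form y) \<le> card (fib y)"
      using degree_fib_form[of y] assms by simp_all
    show "form_eval (card (fib y)) (fib_form y) z = 0" if "z \<in> fib y" for z
      using that unfolding assms fib_iff .
  qed blast
  have "lead_coeff (fib_form y) = c * (if Infty \<in> fib y then -1 else 1)"
    using prod_lin_lead_coeff[OF finite_fib, of y] c by (simp add: lead_coeff_smult)
  hence "c = fib_lead y"
    by (auto simp: fib_lead_def)
  thus 1: "fib_form y = smult (fib_lead y) (\<Prod>z\<in>fib y. lin z)"
    using c by simp
  thus "fib_lead y \<noteq> 0"
    using fib_form_nonzero[of y] by auto
  have "form_eval d (fib_form y) x = fib_lead y * (\<Prod>z\<in>fib y. wedge x z)"
    using form_eval_prod_lin(2)[OF finite_fib, of y x]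
    by (subst 1) (simp add: form_eval_smult assms)
  thus "lift_factor x * wedge (rmap x) y = fib_lead y * (\<Prod>z\<in>fib y. wedge x z)"
    by (simp add: fib_form_eval)
qed

lemma degree_wronskian: "degree wronskian \<le> 2 * d - 2"
proof (rule degree_le, intro allI impI)
  fix i assume i: "i > 2 * d - 2"
  have PQ: "degree (pderiv P) \<le> d - 1" "degree (pderiv Q) \<le> d - 1"
    using degree_pderiv_le degree_P degree_Q by auto
  show "coeff wronskian i = 0"
  proof (cases "i = 2 * d - 1")
    case True
    have i: "i = (d - 1) + d" "i = d + (d - 1)" "Suc (d - 1) = d"
      using True d_ge_2 by auto
    have "coeff (pderiv P * Q) i = coeff (pderiv P) (d - 1) * coeff Q d"
      unfolding i(1) by (rule coeff_mult_top[OF PQ(1) degree_Q])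
    moreover have "coeff (P * pderiv Q) i = coeff P d * coeff (pderiv Q) (d - 1)"
      unfolding i(2) by (rule coeff_mult_top[OF degree_P PQ(2)])
    ultimately show ?thesis
      using i(3) by (simp add: wronskian_def coeff_pderiv del: of_nat_Suc)
  next
    case False
    have "degree (pderiv P * Q) \<le> (d - 1) + d" "degree (P * pderiv Q) \<le> d + (d - 1)"
      using PQ degree_P degree_Q by (intro order_trans[OF degree_mult_le] add_mono; simp)+
    thus ?thesis
      using False i by (simp add: wronskian_def coeff_eq_0)
  qed
qed

text \<open>
  Subtracting a multiple of one component from the other does not change the Wronskian, so it
  can be computed from \<open>fib_form (rmap x)\<close>, which vanishes at \<open>x\<close>. Then only the derivative of the
  factor \<^term>\<open>lin x\<close> contributes.
\<close>

lemma wronskian_eval: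
  assumes "fib_form (rmap x) = lin x * g" "degree g \<le> d - 1"
  shows "form_eval (2 * d - 2) wronskian x = lift_factor x * form_eval (d - 1) g x"
proof (cases x)
  case (Fin a)
  obtain y0 y1 where y: "form_eval d P x = lift_factor x * y0" "form_eval d Q x = lift_factor x * y1"
     "fib_form (rmap x) = smult y1 P - smult y0 Q"
  proof (cases "form_eval d Q x = 0")
    case True
    thus ?thesis
      by (intro that[of 1 0]) (simp_all add: fib_form_def rmap_def lift_factor_def)
  next
    case False
    thus ?thesis
      by (intro that[of "form_eval d P x / form_eval d Q x" 1])
        (simp_all add: fib_form_def rmap_def lift_factor_def)
  qed
  have "poly (pderiv (fib_form (rmap x))) a = y1 * poly (pderiv P) a - y0 * poly (pderiv Q) a"
    by (simp add: y(3) pderiv_diff pderiv_smult)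
  moreover have "poly (pderiv (fib_form (rmap x))) a = poly g a"
    unfolding assms(1) by (simp add: Fin pderiv_mult pderiv_pCons del: mult_pCons_left)
  moreover have "poly wronskian a = lift_factor x * (y1 * poly (pderiv P) a - y0 * poly (pderiv Q) a)"
    using y(1,2) by (simp add: Fin wronskian_def algebra_simps)
  ultimately show ?thesis
    by (simp add: Fin)
next
  case Infty
  obtain e where e: "d = Suc (Suc e)"
    using d_ge_2 by (metis add_2_eq_Suc le_Suc_ex)
  have PQ: "degree (pderiv P) \<le> Suc e" "degree (pderiv Q) \<le> Suc e"
    using degree_pderiv_le[OF degree_P] degree_pderiv_le[OF degree_Q] e by auto
  \<comment> \<open>The value at infinity is the coefficient just below the top one, which cancels.\<close>
  have "coeff (pderiv P * Q) (Suc (e + Suc e)) =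
      coeff (pderiv P) (Suc e) * coeff Q (Suc e) + coeff (pderiv P) e * coeff Q d"
    using coeff_mult_below_top[of "pderiv P" e Q "Suc e"] PQ degree_Q e by simp
  moreover have "coeff (P * pderiv Q) (Suc (Suc e + e)) =
      coeff P d * coeff (pderiv Q) e + coeff P (Suc e) * coeff (pderiv Q) (Suc e)"
    using coeff_mult_below_top[of P "Suc e" "pderiv Q" e] PQ degree_P e by simp
  moreover have "2 * d - 2 = Suc (e + Suc e)" "2 * d - 2 = Suc (Suc e + e)"
    using e by simp_all
  ultimately have "coeff wronskian (2 * d - 2) =
      (coeff (pderiv P) (Suc e) * coeff Q (Suc e) + coeff (pderiv P) e * coeff Q d) -
      (coeff P d * coeff (pderiv Q) e + coeff P (Suc e) * coeff (pderiv Q) (Suc e))"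
    unfolding wronskian_def coeff_diff by simp
  also have "\<dots> = coeff P d * coeff Q (Suc e) - coeff P (Suc e) * coeff Q d"
    by (simp add: coeff_pderiv e algebra_simps)
  finally have W: "coeff wronskian (2 * d - 2) = \<dots>" .
  have g: "g = - fib_form (rmap Infty)"
    using assms(1) Infty by simp
  have d: "d - 1 = Suc e"
    using e by simp
  show ?thesis
  proof (cases "coeff Q d = 0")
    case True
    thus ?thesis
      by (simp only: Infty form_eval.simps W d) (simp add: g lift_factor_def rmap_def fib_form_def)
  next
    case False
    thus ?thesis
      by (simp only: Infty form_eval.simps W d)
        (simp add: g lift_factor_def rmap_def fib_form_def field_simps)
  qed
qed

lemma wronskian_eval_fib:
  assumes "card (fib (rmap x)) = d"
  shows "form_eval (2 * d - 2) wronskian x =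
    lift_factor x * fib_lead (rmap x) * (\<Prod>z\<in>fib (rmap x) - {x}. wedge x z)"
proof -
  let ?Z = "fib (rmap x) - {x}"
  have x: "x \<in> fib (rmap x)"
    by (simp add: fib_def)
  have card: "card ?Z = d - 1"
    using assms x by simp
  have "fib_form (rmap x) = lin x * smult (fib_lead (rmap x)) (\<Prod>z\<in>?Z. lin z)"
    using fib_factor(1)[OF assms] prod.remove[OF finite_fib x, of lin] by simp
  moreover have "degree (smult (fib_lead (rmap x)) (\<Prod>z\<in>?Z. lin z)) \<le> d - 1"
    using form_eval_prod_lin(1)[of ?Z] card by (intro order_trans[OF degree_smult_le]) simp
  ultimately have "form_eval (2 * d - 2) wronskian x =
      lift_factor x * form_eval (d - 1) (smult (fib_lead (rmap x)) (\<Prod>z\<in>?Z. lin z)) x"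
    by (rule wronskian_eval)
  thus ?thesis
    using form_eval_prod_lin(2)[of ?Z x] card by (simp add: form_eval_smult)
qed

text \<open>
  A simple zero of the fibre form leaves a cofactor that does not vanish at \<open>x\<close>, and by the
  preceding formula this cofactor is the Wronskian up to a nonzero factor.
\<close>

lemma wronskian_zero_imp_double:
  assumes "form_eval (2 * d - 2) wronskian x = 0"
  obtains g where "fib_form (rmap x) = lin x * (lin x * g)" "degree g \<le> d - 2"
proof -
  have "x \<in> fib (rmap x)"
    by (simp add: fib_def)
  hence "form_eval (Suc (d - 1)) (fib_form (rmap x)) x = 0"
    using d_ge_2 by (simp add: fib_iff)
  then obtain h where h: "fib_form (rmap x) = lin x * h" "degree h \<le> d - 1"
    using form_divide_lin[of "fib_form (rmap x)" "d - 1" x] degree_fib_form d_ge_2 by auto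
  have deg_h: "degree h \<le> Suc (d - 2)"
    using h(2) d_ge_2 by linarith
  have "form_eval (Suc (d - 2)) h x = 0"
    using wronskian_eval[OF h] assms d_ge_2 by (simp add: Suc_diff_Suc numeral_2_eq_2)
  then obtain g where "h = lin x * g" "degree g \<le> d - 2"
    using form_divide_lin[OF deg_h] by blast
  thus ?thesis
    using that h(1) by simp
qed

text \<open>
  Evaluate the form of the second fibre at the points of the first, once through its factors and
  once through the rational map.
\<close>

lemma fib_pairing:
  assumes "card (fib y) = d" "card (fib y') = d"
  shows "(\<Prod>x\<in>fib y. \<Prod>x'\<in>fib y'. wedge x x') * fib_lead y' ^ d = fib_lift_factor y * wedge y y' ^ d"
proof -
  have "(\<Prod>x\<in>fib y. lift_factor x * wedge (rmap x) y') = (\<Prod>x\<in>fib y. fib_lead y' * (\<Prod>z\<in>fib y'. wedge x z))"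
    using fib_factor(3)[OF assms(2)] by (intro prod.cong) auto
  moreover have "(\<Prod>x\<in>fib y. wedge (rmap x) y') = wedge y y' ^ d"
  proof -
    have "(\<Prod>x\<in>fib y. wedge (rmap x) y') = (\<Prod>x\<in>fib y. wedge y y')"
      by (intro prod.cong) (simp_all add: fib_def)
    thus ?thesis
      by (simp add: assms(1))
  qed
  ultimately show ?thesis
    by (simp add: prod.distrib fib_lift_factor_def assms(1) mult.commute)
qed

text \<open>
  Exchanging the two fibres in the pairing gives the same product up to a sign, and the sign
  \<open>(-1) ^ (d * d + d)\<close> is 1. The common value is the resultant of \<open>P\<close> and \<open>Q\<close> up to sign.
\<close>

lemma fib_resultant_const:
  assumes "card (fib y) = d" "card (fib y') = d"
  shows "fib_lift_factor y * fib_lead y ^ d = fib_lift_factor y' * fib_lead y' ^ d"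
proof (cases "y = y'")
  case False
  define S where "S = (\<Prod>x\<in>fib y. \<Prod>x'\<in>fib y'. wedge x x')"
  define S' where "S' = (\<Prod>x\<in>fib y'. \<Prod>x'\<in>fib y. wedge x x')"
  have "S' = (\<Prod>x'\<in>fib y. \<Prod>x\<in>fib y'. wedge x x')"
    unfolding S'_def by (rule prod.swap)
  also have "\<dots> = (\<Prod>x'\<in>fib y. \<Prod>x\<in>fib y'. - 1 * wedge x' x)"
  proof (intro prod.cong refl)
    show "wedge x x' = - 1 * wedge x' x" for x x' :: "'k proj_line"
      using wedge_commute[of x x'] by simp
  qed
  also have "\<dots> = (-1) ^ (d * d) * S"
    by (simp only: S_def prod.distrib prod_constant assms power_mult)
  finally have S': "S' = (-1) ^ (d * d) * S" .
  have "wedge y' y ^ d = (-1) ^ d * wedge y y' ^ d"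
    using wedge_commute[of y' y] by (simp flip: power_mult_distrib)
  with fib_pairing[OF assms(2,1)] S'
  have "(-1) ^ (d * d) * S * fib_lead y ^ d = fib_lift_factor y' * ((-1) ^ d * wedge y y' ^ d)"
    by (simp add: S'_def)
  moreover have "(-1 :: 'k) ^ (d * d) = (-1) ^ d"
    by (cases "even d") simp_all
  ultimately have "S * fib_lead y ^ d = fib_lift_factor y' * wedge y y' ^ d"
    by (cases "even d") simp_all
  moreover have "S * fib_lead y' ^ d = fib_lift_factor y * wedge y y' ^ d"
    using fib_pairing[OF assms] by (simp add: S_def)
  ultimately have "fib_lift_factor y * wedge y y' ^ d * fib_lead y ^ d =
      fib_lift_factor y' * wedge y y' ^ d * fib_lead y' ^ d"
    by (metis mult.assoc mult.commute)
  thus ?thesis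
    using False by simp
qed simp

end


section \<open>Discriminants of the levels of the preimage tree\<close>

text \<open>
  Each orbit has its own preperiod and period; take the maximum of the former and the product of
  the latter.
\<close>

lemma eventually_periodic_common:
  fixes f :: "'a \<Rightarrow> 'a"
  assumes "finite S" "\<And>c. c \<in> S \<Longrightarrow> finite {(f ^^ n) c | n. True}"
  obtains m r :: nat where "r > 0" "\<And>c n. c \<in> S \<Longrightarrow> n \<ge> m \<Longrightarrow> (f ^^ (n + r)) c = (f ^^ n) c"
proof -
  have "\<exists>m r. r > 0 \<and> (\<forall>c\<in>S. \<forall>n\<ge>m. (f ^^ (n + r)) c = (f ^^ n) c)"
    using assms
  proof (induction S)
    case empty
    thus ?case by (auto intro: exI[of _ 1])
  next
    case (insert c S)
    obtain m r where mr: "r > 0" "\<And>c n. c \<in> S \<Longrightarrow> n \<ge> m \<Longrightarrow> (f ^^ (n + r)) c = (f ^^ n) c"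
      using insert.IH insert.prems by (metis insertCI)
    have "finite (range (\<lambda>n. (f ^^ n) c))"
      using insert.prems[of c] by (simp add: full_SetCompr_eq)
    hence "\<not> inj (\<lambda>n. (f ^^ n) c)"
      using finite_imageD infinite_UNIV_nat by blast
    then obtain i j where ij: "i < j" "(f ^^ j) c = (f ^^ i) c"
      unfolding inj_def by (metis linorder_neqE_nat)
    have per: "(f ^^ (n + (j - i) * k)) c = (f ^^ n) c" if "n \<ge> i" for n k
    proof (induction k)
      case (Suc k)
      have eq: "n + (j - i) * Suc k = (n - i) + (j - i) * k + j"
        unfolding mult_Suc_right using that ij(1) by linarith
      have "(f ^^ (n + (j - i) * Suc k)) c = (f ^^ ((n - i) + (j - i) * k)) ((f ^^ j) c)"
        unfolding eq funpow_add[of _ j] by simp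
      also have "\<dots> = (f ^^ ((n - i) + (j - i) * k + i)) c"
        by (simp add: ij(2) funpow_add)
      also have "(n - i) + (j - i) * k + i = n + (j - i) * k"
        using that by simp
      finally show ?case using Suc by simp
    qed simp
    have per': "(f ^^ (n + r * k)) c' = (f ^^ n) c'" if "n \<ge> m" "c' \<in> S" for n k c'
    proof (induction k)
      case (Suc k)
      have "(f ^^ (n + r * k + r)) c' = (f ^^ (n + r * k)) c'"
        using mr(2)[OF that(2), of "n + r * k"] that(1) by simp
      thus ?case using Suc by (simp add: algebra_simps)
    qed simp
    have "(f ^^ (n + (j - i) * r)) c' = (f ^^ n) c'" if "c' \<in> insert c S" "n \<ge> max i m" for n c'
    proof (cases "c' = c")
      case True
      thus ?thesis using per[of n r] that(2) by simp
    next
      case False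
      thus ?thesis using per'[of n c' "j - i"] that by (simp add: mult.commute)
    qed
    moreover have "(j - i) * r > 0"
      using ij(1) mr(1) by simp
    ultimately show ?case by blast
  qed
  thus ?thesis using that by blast
qed

locale preimage_tree = rational_map +
  assumes card_level: "card {x. (rmap ^^ n) x = Fin 0} = d ^ n"
begin

definition level :: "nat \<Rightarrow> 'a proj_line set" where
  "level n = {x. (rmap ^^ n) x = Fin 0}"

text \<open>
  The discriminant of the form whose zeros are the points of level \<open>n\<close>, up to sign and a square.
\<close>

definition disc :: "nat \<Rightarrow> 'a" where
  "disc n = (\<Prod>x\<in>level n. \<Prod>x'\<in>level n - {x}. wedge x x')"

definition wronskian_prod :: "nat \<Rightarrow> 'a" where
  "wronskian_prod n = (\<Prod>x\<in>level n. form_eval (2 * d - 2) wronskian x)"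

definition lead_prod :: "nat \<Rightarrow> 'a" where
  "lead_prod n = (\<Prod>y\<in>level n. fib_lead y)"

definition resultant :: 'a where
  "resultant = fib_lift_factor (Fin 0) * fib_lead (Fin 0) ^ d"

lemma finite_level [simp]: "finite (level n)" and card_level' [simp]: "card (level n) = d ^ n"
  using card_level[of n] d_ge_2 by (auto simp: level_def intro: card_ge_0_finite)

lemma level_0: "level 0 = {Fin 0}"
  by (auto simp: level_def)

lemma level_Suc: "level (Suc n) = (\<Union>y\<in>level n. fib y)"
  by (auto simp: level_def fib_def funpow_swap1)

lemma disjoint_fib: "y \<noteq> y' \<Longrightarrow> fib y \<inter> fib y' = {}"
  by (auto simp: fib_def)

lemma rmap_level: "x \<in> level (Suc n) \<Longrightarrow> rmap x \<in> level n"
  by (auto simp: level_Suc fib_def)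

text \<open>
  The sizes of the \<open>d ^ n\<close> fibres, each at most \<open>d\<close>, add up to \<open>d ^ (n + 1)\<close>.
\<close>

lemma card_fib:
  assumes "y \<in> level n"
  shows "card (fib y) = d"
proof (rule ccontr)
  assume "card (fib y) \<noteq> d"
  hence "card (fib y) < d"
    using card_fib_le[of y] by simp
  hence "(\<Sum>y\<in>level n. card (fib y)) < (\<Sum>y\<in>level n. d)"
    using assms card_fib_le by (intro sum_strict_mono_ex1) auto
  moreover have "card (level (Suc n)) = (\<Sum>y\<in>level n. card (fib y))"
    unfolding level_Suc using disjoint_fib by (intro card_UN_disjoint) auto
  ultimately show False by (simp add: mult.commute)
qed

lemma prod_level_Suc: "(\<Prod>x\<in>level (Suc n). g x) = (\<Prod>y\<in>level n. \<Prod>x\<in>fib y. g x)"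
  unfolding level_Suc using disjoint_fib by (intro prod.UNION_disjoint) auto

lemma fib_lead_nonzero: "y \<in> level n \<Longrightarrow> fib_lead y \<noteq> 0"
  using fib_factor(2) card_fib by blast

lemma lead_prod_nonzero [simp]: "lead_prod n \<noteq> 0"
  using fib_lead_nonzero by (auto simp: lead_prod_def)

lemma disc_nonzero [simp]: "disc n \<noteq> 0"
  by (auto simp: disc_def)

lemma resultant_nonzero [simp]: "resultant \<noteq> 0"
  using fib_lead_nonzero[of "Fin 0" 0] by (auto simp: resultant_def fib_lift_factor_def level_0)

lemma resultant_eq: "y \<in> level n \<Longrightarrow> fib_lift_factor y * fib_lead y ^ d = resultant"
  unfolding resultant_def using fib_resultant_const card_fib[of y n] card_fib[of "Fin 0" 0] level_0 by blast

lemma wronskian_nonzero_level: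
  assumes "x \<in> level (Suc n)"
  shows "form_eval (2 * d - 2) wronskian x \<noteq> 0"
  using wronskian_eval_fib[of x] card_fib[OF rmap_level[OF assms]]
    fib_lead_nonzero[OF rmap_level[OF assms]] by simp

lemma wronskian_prod_nonzero [simp]: "wronskian_prod (Suc n) \<noteq> 0"
  using wronskian_nonzero_level by (auto simp: wronskian_prod_def)

text \<open>
  Up to the resultant, the discriminant of a single fibre is the product of the values of the
  Wronskian on it.
\<close>

lemma disc_fib:
  assumes "y \<in> level n"
  shows "(\<Prod>x\<in>fib y. \<Prod>x'\<in>fib y - {x}. wedge x x') * resultant =
    (\<Prod>x\<in>fib y. form_eval (2 * d - 2) wronskian x)"
proof -
  have "(\<Prod>x\<in>fib y. form_eval (2 * d - 2) wronskian x) =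
      (\<Prod>x\<in>fib y. lift_factor x * fib_lead y * (\<Prod>x'\<in>fib y - {x}. wedge x x'))"
  proof (intro prod.cong refl)
    fix x assume "x \<in> fib y"
    hence "rmap x = y"
      by (simp add: fib_def)
    thus "form_eval (2 * d - 2) wronskian x =
        lift_factor x * fib_lead y * (\<Prod>x'\<in>fib y - {x}. wedge x x')"
      using wronskian_eval_fib[of x] card_fib[OF assms] by simp
  qed
  also have "\<dots> = fib_lift_factor y * fib_lead y ^ d * (\<Prod>x\<in>fib y. \<Prod>x'\<in>fib y - {x}. wedge x x')"
    using card_fib[OF assms] by (simp add: prod.distrib fib_lift_factor_def)
  finally show ?thesis
    using resultant_eq[OF assms] by simp
qed

lemma cross_fib:
  assumes "y \<in> level n" "y' \<in> level n"
  shows "(\<Prod>x\<in>fib y. \<Prod>x'\<in>fib y'. wedge x x') * (fib_lead y ^ d * fib_lead y' ^ d) =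
    resultant * wedge y y' ^ d"
proof -
  have "(\<Prod>x\<in>fib y. \<Prod>x'\<in>fib y'. wedge x x') * fib_lead y' ^ d * fib_lead y ^ d =
      fib_lift_factor y * wedge y y' ^ d * fib_lead y ^ d"
    using fib_pairing[of y y'] card_fib assms by simp
  thus ?thesis
    using resultant_eq[OF assms(1)] by (simp add: mult_ac)
qed

text \<open>
  Pairs of points of level \<open>n + 1\<close> with the same image contribute values of the Wronskian. Pairs
  with different images contribute a power of the wedge of the images, hence the discriminant of
  level \<open>n\<close>. Modulo squares this reads \<open>disc (n + 1) = resultant ^ N * disc n ^ d * wronskian_prod (n + 1)\<close>
  with \<open>N = d ^ n\<close>.
\<close>

lemma disc_Suc:
  "disc (Suc n) * (lead_prod n ^ (d * (d ^ n - 1))) ^ 2 * resultant ^ (d ^ n) =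
    resultant ^ (d ^ n * (d ^ n - 1)) * disc n ^ d * wronskian_prod (Suc n)"
proof -
  define S where "S = (\<lambda>y. \<Prod>x\<in>fib y. \<Prod>x'\<in>fib y - {x}. wedge x x')"
  define T where "T = (\<lambda>y y'. \<Prod>x\<in>fib y. \<Prod>x'\<in>fib y'. wedge x x')"
  let ?L = "level n" and ?N = "d ^ n"
  have "disc (Suc n) = (\<Prod>y\<in>?L. \<Prod>x\<in>fib y. \<Prod>x'\<in>level (Suc n) - {x}. wedge x x')"
    unfolding disc_def by (rule prod_level_Suc)
  also have "\<dots> = (\<Prod>y\<in>?L. S y * (\<Prod>y'\<in>?L - {y}. T y y'))"
  proof (intro prod.cong refl)
    fix y assume y: "y \<in> ?L"
    have "(\<Prod>x'\<in>level (Suc n) - {x}. wedge x x') =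
        (\<Prod>x'\<in>fib y - {x}. wedge x x') * (\<Prod>y'\<in>?L - {y}. \<Prod>x'\<in>fib y'. wedge x x')"
      if x: "x \<in> fib y" for x
    proof -
      have "level (Suc n) - {x} = (fib y - {x}) \<union> (\<Union>y'\<in>?L - {y}. fib y')"
        using x y by (auto simp: level_Suc fib_def)
      moreover have "(fib y - {x}) \<inter> (\<Union>y'\<in>?L - {y}. fib y') = {}"
        by (auto simp: fib_def)
      ultimately have "(\<Prod>x'\<in>level (Suc n) - {x}. wedge x x') =
          (\<Prod>x'\<in>fib y - {x}. wedge x x') * (\<Prod>x'\<in>(\<Union>y'\<in>?L - {y}. fib y'). wedge x x')"
        by (simp add: prod.union_disjoint)
      also have "(\<Prod>x'\<in>(\<Union>y'\<in>?L - {y}. fib y'). wedge x x') =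
          (\<Prod>y'\<in>?L - {y}. \<Prod>x'\<in>fib y'. wedge x x')"
        using disjoint_fib by (intro prod.UNION_disjoint) auto
      finally show ?thesis .
    qed
    hence "(\<Prod>x\<in>fib y. \<Prod>x'\<in>level (Suc n) - {x}. wedge x x') =
        S y * (\<Prod>x\<in>fib y. \<Prod>y'\<in>?L - {y}. \<Prod>x'\<in>fib y'. wedge x x')"
      by (simp add: prod.distrib S_def)
    also have "(\<Prod>x\<in>fib y. \<Prod>y'\<in>?L - {y}. \<Prod>x'\<in>fib y'. wedge x x') = (\<Prod>y'\<in>?L - {y}. T y y')"
      unfolding T_def by (rule prod.swap)
    finally show "(\<Prod>x\<in>fib y. \<Prod>x'\<in>level (Suc n) - {x}. wedge x x') =
        S y * (\<Prod>y'\<in>?L - {y}. T y y')" .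
  qed
  also have "\<dots> = (\<Prod>y\<in>?L. S y) * (\<Prod>y\<in>?L. \<Prod>y'\<in>?L - {y}. T y y')"
    by (rule prod.distrib)
  finally have D: "disc (Suc n) = \<dots>" .
  have S: "(\<Prod>y\<in>?L. S y) * resultant ^ ?N = wronskian_prod (Suc n)"
  proof -
    have "(\<Prod>y\<in>?L. S y) * resultant ^ ?N = (\<Prod>y\<in>?L. S y * resultant)"
      by (simp add: prod.distrib)
    also have "\<dots> = (\<Prod>y\<in>?L. \<Prod>x\<in>fib y. form_eval (2 * d - 2) wronskian x)"
      unfolding S_def by (intro prod.cong disc_fib refl)
    also have "\<dots> = wronskian_prod (Suc n)"
      unfolding wronskian_prod_def by (rule prod_level_Suc[symmetric])
    finally show ?thesis .
  qed
  have lead1: "(\<Prod>y\<in>?L. \<Prod>y'\<in>?L - {y}. fib_lead y ^ d) = lead_prod n ^ (d * (?N - 1))"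
    by (simp add: lead_prod_def prod_power_distrib flip: power_mult)
  have lead2: "(\<Prod>y\<in>?L. \<Prod>y'\<in>?L - {y}. fib_lead y' ^ d) = lead_prod n ^ (d * (?N - 1))"
    using prod_pairs_snd[of ?L "\<lambda>y. fib_lead y ^ d"]
    by (simp add: lead_prod_def power_mult prod_power_distrib)
  have "(\<Prod>y\<in>?L. \<Prod>y'\<in>?L - {y}. T y y') * (lead_prod n ^ (d * (?N - 1))) ^ 2 =
      (\<Prod>y\<in>?L. \<Prod>y'\<in>?L - {y}. T y y' * (fib_lead y ^ d * fib_lead y' ^ d))"
    by (simp only: prod.distrib lead1 lead2 power2_eq_square)
  also have "\<dots> = (\<Prod>y\<in>?L. \<Prod>y'\<in>?L - {y}. resultant * wedge y y' ^ d)"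
    unfolding T_def by (intro prod.cong cross_fib refl) auto
  also have "\<dots> = resultant ^ (?N * (?N - 1)) * disc n ^ d"
    by (simp add: prod.distrib disc_def prod_power_distrib flip: power_mult)
      (simp add: mult.commute)
  finally show ?thesis
    unfolding D S[symmetric] by (simp add: mult_ac)
qed

text \<open>
  The factor between the value of the \<open>n\<close>-fold iterate of \<open>(P, Q)\<close> at the coordinates of \<open>x\<close> and
  the coordinates of the \<open>n\<close>-th iterate of \<open>x\<close>.
\<close>

primrec orbit_factor :: "nat \<Rightarrow> 'a proj_line \<Rightarrow> 'a" where
  "orbit_factor 0 x = 1"
| "orbit_factor (Suc n) x = orbit_factor n x ^ d * lift_factor ((rmap ^^ n) x)"

lemma orbit_factor_Suc': "orbit_factor (Suc n) x = lift_factor x ^ (d ^ n) * orbit_factor n (rmap x)"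
proof (induction n)
  case (Suc n)
  have "orbit_factor (Suc (Suc n)) x = orbit_factor (Suc n) x ^ d * lift_factor ((rmap ^^ n) (rmap x))"
    by (simp add: funpow_swap1)
  thus ?case
    by (simp only: Suc power_mult_distrib orbit_factor.simps(2)[of n "rmap x"])
      (simp add: mult_ac flip: power_mult)
qed simp

definition lead_upto :: "nat \<Rightarrow> 'a" where
  "lead_upto n = (\<Prod>k<n. lead_prod k)"

text \<open>
  The value at \<open>x\<close> of the numerator of the \<open>n\<close>-fold iterate, a form of degree \<open>d ^ n\<close>.
\<close>

definition iter_num :: "nat \<Rightarrow> 'a proj_line \<Rightarrow> 'a" where
  "iter_num n x = orbit_factor n x * wedge ((rmap ^^ n) x) (Fin 0)"

lemma lead_upto_nonzero [simp]: "lead_upto n \<noteq> 0"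
  by (auto simp: lead_upto_def)

text \<open>
  The zeros of the numerator of the iterate are the points of level \<open>n\<close>.
\<close>

lemma iter_num_factor: "iter_num n x = lead_upto n * (\<Prod>z\<in>level n. wedge x z)"
proof (induction n arbitrary: x)
  case (Suc n)
  have "iter_num (Suc n) x = lift_factor x ^ (d ^ n) * iter_num n (rmap x)"
    unfolding iter_num_def orbit_factor_Suc' by (simp add: funpow_swap1)
  also have "\<dots> = lead_upto n * (\<Prod>y\<in>level n. lift_factor x * wedge (rmap x) y)"
    by (simp add: Suc prod.distrib)
  also have "(\<Prod>y\<in>level n. lift_factor x * wedge (rmap x) y) =
      (\<Prod>y\<in>level n. fib_lead y * (\<Prod>z\<in>fib y. wedge x z))"
    by (intro prod.cong refl fib_factor(3) card_fib)
  also have "\<dots> = lead_prod n * (\<Prod>z\<in>level (Suc n). wedge x z)"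
    by (simp add: prod.distrib lead_prod_def prod_level_Suc)
  finally show ?case
    by (simp add: lead_upto_def)
qed (simp add: iter_num_def lead_upto_def level_0)

lemma wronskian_splits:
  obtains w C where "w \<noteq> 0" "size C = 2 * d - 2" "wronskian = smult w (\<Prod>c\<in>#C. lin c)"
    "\<And>c. c \<in># C \<Longrightarrow> form_eval (2 * d - 2) wronskian c = 0"
proof -
  have "level 1 \<noteq> {}"
    using card_level'[of 1] d_ge_2 by (metis card.empty not_numeral_le_zero power_one_right)
  hence "wronskian \<noteq> 0"
    using wronskian_nonzero_level[of _ 0] by (metis One_nat_def all_not_in_conv coeff_0 form_eval.elims poly_0)
  then obtain w C where wC: "w \<noteq> 0" "size C = 2 * d - 2" "wronskian = smult w (\<Prod>c\<in>#C. lin c)"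
    using form_splits degree_wronskian by metis
  have "form_eval (2 * d - 2) wronskian c = 0" if "c \<in># C" for c
    using that unfolding wC(3) form_eval_smult wC(2)[symmetric] form_eval_prod_mset_lin
    by (auto simp: prod_mset_zero_iff)
  thus ?thesis using that wC by blast
qed

text \<open>
  Multiplying by an even power of the leading factor of the numerator leaves the square class of
  \<^term>\<open>wronskian_prod n\<close> unchanged and makes it a product over the critical points.
\<close>

definition wronskian_norm :: "nat \<Rightarrow> 'a" where
  "wronskian_norm n = lead_upto n ^ (2 * d - 2) * wronskian_prod n"

lemma wronskian_norm_nonzero [simp]: "wronskian_norm (Suc n) \<noteq> 0"
  by (simp add: wronskian_norm_def)

text \<open>
  The product of all wedges between critical points and points of level \<open>n\<close> can be taken in either
  order. No sign appears because there are \<open>2 * d - 2\<close> critical points.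
\<close>

lemma wronskian_norm_eq:
  assumes "size C = 2 * d - 2" "wronskian = smult w (\<Prod>c\<in>#C. lin c)"
  shows "wronskian_norm n = w ^ (d ^ n) * (\<Prod>c\<in>#C. iter_num n c)"
proof -
  have "(\<Prod>x\<in>level n. \<Prod>c\<in>#C. wedge x c) = (\<Prod>c\<in>#C. \<Prod>x\<in>level n. wedge x c)"
    by (induction C) (simp_all add: prod.distrib)
  moreover have "form_eval (2 * d - 2) wronskian x = w * (\<Prod>c\<in>#C. wedge x c)" for x
    unfolding assms(2) form_eval_smult assms(1)[symmetric] form_eval_prod_mset_lin ..
  ultimately have "wronskian_prod n = w ^ (d ^ n) * (\<Prod>c\<in>#C. \<Prod>x\<in>level n. wedge x c)"
    by (simp add: wronskian_prod_def prod.distrib)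
  moreover have "(\<Prod>c\<in>#C. iter_num n c) =
      (lead_upto n * (-1) ^ (d ^ n)) ^ size C * (\<Prod>c\<in>#C. \<Prod>x\<in>level n. wedge x c)"
  proof (induction C)
    case (add c C)
    have "(\<Prod>x\<in>level n. wedge c x) = (\<Prod>x\<in>level n. - 1 * wedge x c)"
    proof (intro prod.cong refl)
      show "wedge c x = - 1 * wedge x c" for x
        using wedge_commute[of c x] by simp
    qed
    also have "\<dots> = (-1) ^ (d ^ n) * (\<Prod>x\<in>level n. wedge x c)"
      by (simp only: prod.distrib prod_constant card_level')
    finally show ?case
      using add by (simp add: iter_num_factor mult_ac)
  qed simp
  moreover have "((-1 :: 'a) ^ (d ^ n)) ^ size C = 1"
    unfolding assms(1) by (simp add: power_mult[symmetric])
  ultimately show ?thesis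
    by (simp add: wronskian_norm_def assms(1) power_mult_distrib mult_ac)
qed

text \<open>
  Here post-critical finiteness enters. Once the critical orbits are periodic with period \<open>r\<close>, the
  factors by which the iterates \<open>n + r\<close> and \<open>n\<close> differ at a critical point satisfy
  \<open>\<mu> (n + 1) = \<mu> n ^ d\<close>, because the new factors of \<^term>\<open>lift_factor\<close> cancel. So the ratio of
  \<open>wronskian_norm (n + r)\<close> to \<open>wronskian_norm n\<close> is raised to the power \<open>d\<close> in each step; the equation
  is stated without division.
\<close>

lemma wronskian_norm_recurrence:
  assumes pcf: "\<And>c. form_eval (2 * d - 2) wronskian c = 0 \<Longrightarrow> finite {(rmap ^^ n) c | n. True}"
  obtains m r where "r > 0"
    "\<And>n. n \<ge> m \<Longrightarrow> wronskian_norm (Suc (n + r)) * wronskian_norm n ^ d =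
       wronskian_norm (n + r) ^ d * wronskian_norm (Suc n)"
proof -
  obtain w C where C: "size C = 2 * d - 2" "wronskian = smult w (\<Prod>c\<in>#C. lin c)"
    "\<And>c. c \<in># C \<Longrightarrow> form_eval (2 * d - 2) wronskian c = 0"
    using wronskian_splits by metis
  have "finite {(rmap ^^ n) c | n. True}" if "c \<in># C" for c
    using pcf C(3) that by simp
  then obtain m r where mr: "r > 0"
      "\<And>c n. c \<in># C \<Longrightarrow> n \<ge> m \<Longrightarrow> (rmap ^^ (n + r)) c = (rmap ^^ n) c"
    using eventually_periodic_common[OF finite_set_mset[of C], of rmap] by metis
  have "wronskian_norm (Suc (n + r)) * wronskian_norm n ^ d = wronskian_norm (n + r) ^ d * wronskian_norm (Suc n)"
    if n: "n \<ge> m" for n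
  proof -
    have *: "iter_num (Suc (n + r)) c * iter_num n c ^ d = iter_num (n + r) c ^ d * iter_num (Suc n) c"
      if c: "c \<in># C" for c
    proof -
      have per0: "(rmap ^^ (n + r)) c = (rmap ^^ n) c"
        using c n by (rule mr(2))
      have "(rmap ^^ (Suc n + r)) c = (rmap ^^ Suc n) c"
        using c le_SucI[OF n] by (rule mr(2))
      hence per1: "(rmap ^^ Suc (n + r)) c = (rmap ^^ Suc n) c"
        unfolding add_Suc .
      define l where "l = lift_factor ((rmap ^^ n) c)"
      define w0 where "w0 = wedge ((rmap ^^ n) c) (Fin 0)"
      define w1 where "w1 = wedge ((rmap ^^ Suc n) c) (Fin 0)"
      have E: "iter_num (Suc (n + r)) c = orbit_factor (n + r) c ^ d * l * w1"
        "iter_num (Suc n) c = orbit_factor n c ^ d * l * w1"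
        "iter_num (n + r) c = orbit_factor (n + r) c * w0"
        "iter_num n c = orbit_factor n c * w0"
        unfolding iter_num_def orbit_factor.simps(2) per0 per1 l_def w0_def w1_def by (rule refl)+
      have "(x * l * w1) * (y * w0 ^ d) = (x * w0 ^ d) * (y * l * w1)" for x y :: 'a
        by simp
      thus ?thesis
        unfolding E power_mult_distrib .
    qed
    have "(\<Prod>c\<in>#C. iter_num (Suc (n + r)) c * iter_num n c ^ d) =
        (\<Prod>c\<in>#C. iter_num (n + r) c ^ d * iter_num (Suc n) c)"
      using * by (intro arg_cong[of _ _ prod_mset] image_mset_cong)
    moreover have "(\<Prod>c\<in>#C. g c ^ d) = (\<Prod>c\<in>#C. g c) ^ d" for g :: "'a proj_line \<Rightarrow> 'a"
      by (induction C) (simp_all add: power_mult_distrib)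
    ultimately have "(\<Prod>c\<in>#C. iter_num (Suc (n + r)) c) * (\<Prod>c\<in>#C. iter_num n c) ^ d =
        (\<Prod>c\<in>#C. iter_num (n + r) c) ^ d * (\<Prod>c\<in>#C. iter_num (Suc n) c)"
      by (simp add: prod_mset.distrib)
    thus ?thesis
      unfolding wronskian_norm_eq[OF C(1,2)]
      by (simp add: power_mult_distrib mult_ac flip: power_mult)
  qed
  thus ?thesis using that mr(1) by blast
qed

end


section \<open>Square classes\<close>

locale mult_closed =
  fixes L :: "'k::field set"
  assumes one_mem [simp]: "1 \<in> L" and mult_mem [simp]: "x \<in> L \<Longrightarrow> y \<in> L \<Longrightarrow> x * y \<in> L"
begin

text \<open>
  Triviality in the group of square classes. The denominator \<open>s\<close> is kept because \<open>L\<close> is only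
  assumed to be closed under multiplication. Two elements are in the same class when their product
  satisfies the predicate.
\<close>

definition sq :: "'k \<Rightarrow> bool" where
  "sq x \<longleftrightarrow> (\<exists>s\<in>L - {0}. \<exists>t\<in>L - {0}. x * s ^ 2 = t ^ 2)"

lemma power_mem [simp]: "x \<in> L \<Longrightarrow> x ^ n \<in> L"
  by (induction n) auto

lemma prod_mem: "(\<And>i. i \<in> I \<Longrightarrow> f i \<in> L) \<Longrightarrow> prod f I \<in> L"
  by (induction I rule: infinite_finite_induct) auto

lemma sqI: "x * s ^ 2 = t ^ 2 \<Longrightarrow> s \<in> L - {0} \<Longrightarrow> t \<in> L - {0} \<Longrightarrow> sq x"
  unfolding sq_def by blast

lemma sq_square: "x \<in> L - {0} \<Longrightarrow> sq (x ^ 2)"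
  by (rule sqI[of _ 1 x]) auto

lemma sq_mult: 
  assumes "sq x" "sq y"
  shows "sq (x * y)"
proof -
  obtain s t s' t' where *: "s \<in> L - {0}" "t \<in> L - {0}" "s' \<in> L - {0}" "t' \<in> L - {0}"
      "x * s ^ 2 = t ^ 2" "y * s' ^ 2 = t' ^ 2"
    using assms unfolding sq_def by blast
  have "(x * y) * (s * s') ^ 2 = (x * s ^ 2) * (y * s' ^ 2)"
    by (simp add: power_mult_distrib mult_ac)
  also have "\<dots> = (t * t') ^ 2"
    by (simp only: * power_mult_distrib)
  finally show ?thesis
    by (rule sqI) (use * in auto)
qed

lemma sq_cancel:
  assumes "sq (x * y ^ 2)" "y \<in> L - {0}"
  shows "sq x"
proof -
  obtain s t where *: "s \<in> L - {0}" "t \<in> L - {0}" "x * y ^ 2 * s ^ 2 = t ^ 2"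
    using assms unfolding sq_def by blast
  hence "x * (y * s) ^ 2 = t ^ 2"
    by (simp add: power_mult_distrib mult.assoc)
  thus ?thesis
    by (rule sqI) (use * assms in auto)
qed

lemma sq_trans:
  assumes "sq (x * y)" "sq (y * z)" "y \<in> L - {0}"
  shows "sq (x * z)"
proof (rule sq_cancel)
  have eq: "(x * y) * (y * z) = x * z * y ^ 2"
    by (simp add: power2_eq_square)
  show "sq (x * z * y ^ 2)"
    using sq_mult[OF assms(1,2)] unfolding eq .
qed (rule assms(3))

lemma sq_cancel_even_power:
  assumes "sq (x * y ^ n)" "y \<in> L - {0}" "even n"
  shows "sq x"
  using assms(1,2) by (intro sq_cancel[of x "y ^ (n div 2)"]) (use assms(3) in \<open>auto simp flip: power_mult\<close>)

lemma sq_odd_power: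
  assumes "sq (x * y ^ n)" "y \<in> L - {0}" "odd n"
  shows "sq (x * y)"
proof (rule sq_cancel_even_power)
  show "sq (x * y * y ^ (n - 1))"
    using assms(1,3) by (cases n) (simp_all add: mult.assoc)
qed (use assms in auto)

lemma sq_steps:
  fixes u :: "nat \<Rightarrow> 'k"
  assumes step: "\<And>n. n \<ge> m \<Longrightarrow> sq (u n * u (n + p))" and u: "\<And>n. n \<ge> m \<Longrightarrow> u n \<in> L - {0}"
    and "n \<ge> m"
  shows "sq (u n * u (n + p * i))"
proof (induction i)
  case 0
  show ?case using sq_square[OF u[OF assms(3)]] by (simp add: power2_eq_square)
next
  case (Suc i)
  have "sq (u (n + p * i) * u (n + p * i + p))"
    using assms(3) by (intro step) simp
  hence "sq (u n * u (n + p * i + p))"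
    by (rule sq_trans[OF Suc]) (use u assms(3) in auto)
  thus ?case
    by (simp add: algebra_simps)
qed

text \<open>
  Write \<open>T n = D (n + r) * D n\<close> and \<open>B n = A (n + r) * A n\<close>. Modulo squares, \<open>B (n + 1) = B n ^ d\<close>
  and \<open>T (n + 1) = T n ^ d * B (n + 1)\<close>. If \<open>d\<close> is even, \<open>B\<close> and then \<open>T\<close> become trivial. If \<open>d\<close> is
  odd, \<open>B\<close> is constant and \<open>T\<close> is multiplied by this constant in each step. In both cases \<open>T\<close> has
  period 2, so \<open>T n * T (n + 2 * r)\<close> and \<open>T (n + r) * T (n + 3 * r)\<close> are squares. Their product
  is \<open>D n * D (n + 4 * r)\<close> up to a square.
\<close>

lemma sq_periodic:
  fixes d m r :: nat and D A :: "nat \<Rightarrow> 'k"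
  assumes m: "m \<ge> 1" and D: "\<And>n. n \<ge> m \<Longrightarrow> D n \<in> L - {0}" and A: "\<And>n. n \<ge> m \<Longrightarrow> A n \<in> L - {0}"
    and R: "R \<in> L - {0}"
    and D_rec: "\<And>n. n \<ge> m \<Longrightarrow> sq (D (Suc n) * (R ^ (d ^ n) * D n ^ d * A (Suc n)))"
    and A_rec: "\<And>n. n \<ge> m \<Longrightarrow> A (Suc (n + r)) * A n ^ d = A (n + r) ^ d * A (Suc n)"
    and n: "n > m"
  shows "sq (D n * D (n + 4 * r))"
proof -
  define T where "T = (\<lambda>n. D (n + r) * D n)"
  define B where "B = (\<lambda>n. A (n + r) * A n)"
  have T: "T n \<in> L - {0}" and B: "B n \<in> L - {0}" if "n \<ge> m" for n
    using D[of n] D[of "n + r"] A[of n] A[of "n + r"] that by (auto simp: T_def B_def)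
  have B_rec: "sq (B (Suc n) * B n ^ d)" if n: "n \<ge> m" for n
  proof -
    have "B (Suc n) * B n ^ d = (A (Suc (n + r)) * A n ^ d) * (A (n + r) ^ d * A (Suc n))"
      by (simp add: B_def power_mult_distrib)
    also have "\<dots> = (A (n + r) ^ d * A (Suc n)) ^ 2"
      by (simp add: A_rec[OF n] power2_eq_square)
    finally show ?thesis
      using sq_square[of "A (n + r) ^ d * A (Suc n)"] A[of "n + r"] A[of "Suc n"] n by auto
  qed
  have T_rec: "sq (T (Suc n) * B (Suc n) * T n ^ d)" if n: "n \<ge> m" for n
  proof -
    have "even (d ^ (n + r) + d ^ n)"
      using n m by auto
    moreover have "sq (T (Suc n) * B (Suc n) * T n ^ d * R ^ (d ^ (n + r) + d ^ n))"
      using sq_mult[OF D_rec[of "n + r"] D_rec[of n]] n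
      by (simp add: T_def B_def power_add power_mult_distrib mult_ac)
    ultimately show ?thesis
      using sq_cancel_even_power R by blast
  qed
  have T_step: "sq (T n * T (n + 2))" if n: "n > m" for n
  proof (cases "even d")
    case True
    have "sq (T n)" if nm: "n > m" for n
    proof -
      obtain k where k: "n = Suc k" "k \<ge> m"
        using nm by (cases n) auto
      have "sq (B n)" "sq (T n * B n)"
        using sq_cancel_even_power[OF B_rec[OF k(2)] B[OF k(2)] True]
          sq_cancel_even_power[OF T_rec[OF k(2)] T[OF k(2)] True] k(1) by simp_all
      hence "sq (T n * B n ^ 2)"
        using sq_mult[of "T n * B n" "B n"] by (simp add: power2_eq_square mult.assoc)
      thus ?thesis
        using sq_cancel B[of n] nm by auto
    qed
    thus ?thesis
      using n by (intro sq_mult) auto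
  next
    case False
    have B1: "sq (B (Suc n) * B n)" and T1: "sq (T (Suc n) * B (Suc n) * T n)" if "n \<ge> m" for n
      using sq_odd_power[OF B_rec B False] sq_odd_power[OF T_rec T False] that by auto
    have "sq ((T (Suc (Suc n)) * B (Suc (Suc n)) * T (Suc n)) * (T (Suc n) * B (Suc n) * T n) *
        (B (Suc (Suc n)) * B (Suc n)))"
      using n by (intro sq_mult T1 B1) auto
    also have "(T (Suc (Suc n)) * B (Suc (Suc n)) * T (Suc n)) * (T (Suc n) * B (Suc n) * T n) *
        (B (Suc (Suc n)) * B (Suc n)) =
      T n * T (n + 2) * (T (Suc n) * B (Suc n) * B (Suc (Suc n))) ^ 2"
      by (simp add: power2_eq_square mult_ac)
    finally show ?thesis
      by (rule sq_cancel) (use T[of "Suc n"] B[of "Suc n"] B[of "Suc (Suc n)"] n in auto)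
  qed
  have T2: "sq (T n * T (n + 2 * r))" if "n > m" for n
    using sq_steps[of "Suc m" T 2 n r] T_step T that by auto
  have "sq ((T n * T (n + 2 * r)) * (T (n + r) * T (n + r + 2 * r)))"
    using n by (intro sq_mult T2) auto
  also have "(T n * T (n + 2 * r)) * (T (n + r) * T (n + r + 2 * r)) =
      D n * D (n + 4 * r) * (D (n + r) * D (n + 2 * r) * D (n + 3 * r)) ^ 2"
  proof -
    have "n + 2 * r + r = n + 3 * r" "n + r + r = n + 2 * r" "n + r + 2 * r = n + 3 * r"
      "n + 3 * r + r = n + 4 * r" by simp_all
    thus ?thesis
      by (simp only: T_def power2_eq_square mult_ac)
  qed
  finally show ?thesis
    by (rule sq_cancel) (use D[of "n + r"] D[of "n + 2 * r"] D[of "n + 3 * r"] n in auto)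
qed

end

text \<open>
  The parity of \<open>a choose 2\<close> depends only on \<open>a\<close> modulo 4.
\<close>

lemma choose_two_parity:
  assumes "4 dvd b"
  shows "even ((a + b) choose 2) \<longleftrightarrow> even (a choose 2)"
proof -
  have Suc: "Suc n choose 2 = n + (n choose 2)" for n
    by (simp add: numeral_2_eq_2)
  have step: "even ((n + 4) choose 2) \<longleftrightarrow> even (n choose 2)" for n
  proof -
    have "n + 4 = Suc (Suc (Suc (Suc n)))" by simp
    thus ?thesis by (simp only: Suc) presburger
  qed
  obtain k where "b = 4 * k" using assms by blast
  moreover have "even ((a + 4 * k) choose 2) \<longleftrightarrow> even (a choose 2)" for k
  proof (induction k)
    case (Suc k)
    thus ?case using step[of "a + 4 * k"] by (simp add: add_ac)
  qed simp
  ultimately show ?thesis by simp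
qed

lemma power_choose_two_parity:
  fixes d :: nat
  assumes "n \<ge> 2" "d > 0"
  shows "even (d ^ (n + 4 * k) choose 2) \<longleftrightarrow> even (d ^ n choose 2)"
proof -
  have "4 dvd d ^ n * (d ^ (4 * k) - 1)"
  proof (cases "even d")
    case True
    hence "d ^ n = d * d * d ^ (n - 2)"
      using assms(1) by (metis le_add_diff_inverse power_add power2_eq_square)
    moreover have "4 dvd d * d"
      using True by (auto elim!: evenE)
    ultimately show ?thesis by auto
  next
    case False
    hence "d mod 4 = 1 \<or> d mod 4 = 3" by presburger
    hence "(d mod 4) ^ 4 mod 4 = 1"
      by (elim disjE) simp_all
    hence "d ^ 4 mod 4 = 1"
      by (simp add: power_mod)
    hence "(d ^ 4) ^ k mod 4 = 1 ^ k mod 4"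
      by (metis power_mod)
    hence "4 dvd d ^ (4 * k) - 1"
      using assms(2) mod_eq_dvd_iff_nat[of 1 "d ^ (4 * k)" 4] by (simp add: power_mult)
    thus ?thesis by simp
  qed
  moreover have "d ^ (n + 4 * k) = d ^ n + d ^ n * (d ^ (4 * k) - 1)"
    using assms(2) by (simp add: power_add algebra_simps)
  ultimately show ?thesis
    using choose_two_parity by metis
qed

text \<open>
  The product of the wedges over unordered pairs, each pair being ordered by its position in the
  list. A permutation of the list multiplies it by the sign of the permutation, and up to a sign
  that depends only on the length it is a square root of the discriminant.
\<close>

fun half_disc :: "'k::field proj_line list \<Rightarrow> 'k" where
  "half_disc [] = 1"
| "half_disc (x # xs) = (\<Prod>y\<leftarrow>xs. wedge x y) * half_disc xs"

lemma half_disc_squared: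
  assumes "distinct xs"
  shows "(\<Prod>x\<in>set xs. \<Prod>y\<in>set xs - {x}. wedge x y) =
    (-1) ^ (length xs choose 2) * half_disc xs ^ 2"
  using assms
proof (induction xs)
  case (Cons x xs)
  let ?h = "\<Prod>y\<in>set xs. wedge x y"
  have x: "x \<notin> set xs" "distinct xs"
    using Cons.prems by auto
  have "(\<Prod>z\<in>set (x # xs). \<Prod>y\<in>set (x # xs) - {z}. wedge z y) =
      ?h * (\<Prod>z\<in>set xs. \<Prod>y\<in>insert x (set xs) - {z}. wedge z y)"
    using x by simp
  also have "(\<Prod>z\<in>set xs. \<Prod>y\<in>insert x (set xs) - {z}. wedge z y) =
      (\<Prod>z\<in>set xs. (- 1 * wedge x z) * (\<Prod>y\<in>set xs - {z}. wedge z y))"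
  proof (intro prod.cong refl)
    fix z assume z: "z \<in> set xs"
    hence "insert x (set xs) - {z} = insert x (set xs - {z})"
      using x by auto
    thus "(\<Prod>y\<in>insert x (set xs) - {z}. wedge z y) =
        (- 1 * wedge x z) * (\<Prod>y\<in>set xs - {z}. wedge z y)"
      using x wedge_commute[of z x] by simp
  qed
  also have "\<dots> = (-1) ^ length xs * ?h * ((-1) ^ (length xs choose 2) * half_disc xs ^ 2)"
    using Cons.IH x
    by (simp only: prod.distrib prod_constant distinct_card)
  also have "?h * \<dots> = (-1) ^ (length xs + (length xs choose 2)) * (?h * half_disc xs) ^ 2"
    by (simp add: power_add power2_eq_square mult_ac)
  also have "?h * half_disc xs = half_disc (x # xs)"
    using x by (simp add: prod.distinct_set_conv_list)
  also have "length xs + (length xs choose 2) = length (x # xs) choose 2"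
    by (simp add: numeral_2_eq_2)
  finally show ?case .
qed (simp add: numeral_2_eq_2)

lemma half_disc_swap: "half_disc (b # a # xs) = - half_disc (a # b # xs)"
  using wedge_commute[of b a] by (simp add: mult_ac)

lemma half_disc_nonzero:
  assumes "distinct xs"
  shows "half_disc xs \<noteq> 0"
  using assms by (induction xs) (auto simp: prod_list_zero_iff)


section \<open>The Galois action\<close>

lemma sep_closure_power: "x \<in> sep_closure \<Longrightarrow> x ^ n \<in> sep_closure"
  using to_ac_in_sep_closure[of 1] by (induction n) (auto intro: sep_closure_mult)

lemma sep_closure_uminus: "x \<in> sep_closure \<Longrightarrow> - x \<in> sep_closure"
  using sep_closure_mult[OF to_ac_in_sep_closure[of "-1"], of x] by simp

lemma sep_closure_diff: "x \<in> sep_closure \<Longrightarrow> y \<in> sep_closure \<Longrightarrow> x - y \<in> sep_closure"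
  using sep_closure_add[of x "- y"] sep_closure_uminus[of y] by simp

lemma sep_closure_sum: "(\<And>i. i \<in> I \<Longrightarrow> f i \<in> sep_closure) \<Longrightarrow> sum f I \<in> sep_closure"
  using to_ac_in_sep_closure[of 0]
  by (induction I rule: infinite_finite_induct) (auto intro: sep_closure_add)

lemma sep_closure_prod: "(\<And>i. i \<in> I \<Longrightarrow> f i \<in> sep_closure) \<Longrightarrow> prod f I \<in> sep_closure"
  using to_ac_in_sep_closure[of 1]
  by (induction I rule: infinite_finite_induct) (auto intro: sep_closure_mult)

text \<open>
  Automorphisms have the value \<^term>\<open>undefined\<close> outside of the separable closure, so this depends on
  the separable closure being closed under addition and multiplication.
\<close>

lemma id_in_galois_sep: "restrict id sep_closure \<in> galois_sep"
  by (auto simp: galois_sep_def Bij_def bij_betw_def inj_on_def sep_closure_add sep_closure_mult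
      to_ac_in_sep_closure)

locale galois_element =
  fixes \<sigma> :: "'a::field alg_closure \<Rightarrow> 'a alg_closure"
  assumes galois: "\<sigma> \<in> galois_sep"
begin

lemma bij: "bij_betw \<sigma> sep_closure sep_closure"
  and hom_add: "x \<in> sep_closure \<Longrightarrow> y \<in> sep_closure \<Longrightarrow> \<sigma> (x + y) = \<sigma> x + \<sigma> y"
  and hom_mult: "x \<in> sep_closure \<Longrightarrow> y \<in> sep_closure \<Longrightarrow> \<sigma> (x * y) = \<sigma> x * \<sigma> y"
  and hom_to_ac [simp]: "\<sigma> (to_ac a) = to_ac a"
  using galois by (auto simp: galois_sep_def Bij_def)

lemma hom_0 [simp]: "\<sigma> 0 = 0" and hom_1 [simp]: "\<sigma> 1 = 1"
  using hom_to_ac[of 0] hom_to_ac[of 1] by simp_all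

lemma mem [simp]: "x \<in> sep_closure \<Longrightarrow> \<sigma> x \<in> sep_closure"
  using bij by (auto simp: bij_betw_def)

lemma inj: "x \<in> sep_closure \<Longrightarrow> y \<in> sep_closure \<Longrightarrow> \<sigma> x = \<sigma> y \<longleftrightarrow> x = y"
  using bij by (auto simp: bij_betw_def inj_on_def)

lemma hom_eq_0_iff: "x \<in> sep_closure \<Longrightarrow> \<sigma> x = 0 \<longleftrightarrow> x = 0"
  using inj[of x 0] to_ac_in_sep_closure[of 0] by simp

lemma hom_uminus: "x \<in> sep_closure \<Longrightarrow> \<sigma> (- x) = - \<sigma> x"
  using hom_mult[OF to_ac_in_sep_closure[of "-1"], of x] hom_to_ac[of "-1"]
  by (simp del: hom_to_ac)

lemma hom_diff: "x \<in> sep_closure \<Longrightarrow> y \<in> sep_closure \<Longrightarrow> \<sigma> (x - y) = \<sigma> x - \<sigma> y"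
  using hom_add[of x "- y"] hom_uminus[of y] sep_closure_uminus[of y] by simp

lemma hom_power: "x \<in> sep_closure \<Longrightarrow> \<sigma> (x ^ n) = \<sigma> x ^ n"
  by (induction n) (auto simp: hom_mult sep_closure_power)

lemma hom_sum: "(\<And>i. i \<in> I \<Longrightarrow> f i \<in> sep_closure) \<Longrightarrow> \<sigma> (sum f I) = (\<Sum>i\<in>I. \<sigma> (f i))"
  by (induction I rule: infinite_finite_induct) (auto simp: hom_add sep_closure_sum)

lemma hom_prod: "(\<And>i. i \<in> I \<Longrightarrow> f i \<in> sep_closure) \<Longrightarrow> \<sigma> (prod f I) = (\<Prod>i\<in>I. \<sigma> (f i))"
  by (induction I rule: infinite_finite_induct) (auto simp: hom_mult sep_closure_prod)

abbreviation act :: "'a alg_closure proj_line \<Rightarrow> 'a alg_closure proj_line" where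
  "act \<equiv> map_proj_line \<sigma>"

lemma act_mem [simp]: "x \<in> proj_line_over sep_closure \<Longrightarrow> act x \<in> proj_line_over sep_closure"
  by (auto simp: proj_line_over_def)

lemma act_inj:
  assumes "x \<in> proj_line_over sep_closure" "y \<in> proj_line_over sep_closure"
  shows "act x = act y \<longleftrightarrow> x = y"
  using assms by (cases x; cases y) (auto simp: proj_line_over_def inj)

lemma wedge_act:
  assumes "x \<in> proj_line_over sep_closure" "y \<in> proj_line_over sep_closure"
  shows "wedge x y \<in> sep_closure" "\<sigma> (wedge x y) = wedge (act x) (act y)"
proof -
  have one: "(1 :: 'a alg_closure) \<in> sep_closure"
    using to_ac_in_sep_closure[of 1] by simp
  have *: "(0 :: 'a alg_closure) \<in> sep_closure" "(-1 :: 'a alg_closure) \<in> sep_closure" "\<sigma> (-1) = -1"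
    using to_ac_in_sep_closure[of 0] sep_closure_uminus[OF one] hom_uminus[OF one] by simp_all
  show "wedge x y \<in> sep_closure" "\<sigma> (wedge x y) = wedge (act x) (act y)"
    using assms one * 
    by (cases x; cases y; force simp: proj_line_over_def hom_diff sep_closure_diff)+
qed

lemma form_eval_act:
  assumes "x \<in> proj_line_over sep_closure"
  shows "form_eval m (map_poly to_ac p) x \<in> sep_closure"
    and "\<sigma> (form_eval m (map_poly to_ac p) x) = form_eval m (map_poly to_ac p) (act x)"
proof -
  have poly: "poly (map_poly to_ac p) a = (\<Sum>i\<le>degree p. to_ac (coeff p i) * a ^ i)" for a
    by (simp add: poly_altdef coeff_map_poly)
  have "form_eval m (map_poly to_ac p) x \<in> sep_closure \<and>
      \<sigma> (form_eval m (map_poly to_ac p) x) = form_eval m (map_poly to_ac p) (act x)"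
  proof (cases x)
    case (Fin a)
    hence a: "a \<in> sep_closure"
      using assms by (auto simp: proj_line_over_def)
    have "to_ac (coeff p i) * a ^ i \<in> sep_closure" for i
      by (intro sep_closure_mult to_ac_in_sep_closure sep_closure_power a)
    thus ?thesis
      using a by (simp add: Fin poly sep_closure_sum hom_sum hom_mult hom_power
          to_ac_in_sep_closure sep_closure_power)
  qed (simp add: coeff_map_poly to_ac_in_sep_closure)
  thus "form_eval m (map_poly to_ac p) x \<in> sep_closure"
    and "\<sigma> (form_eval m (map_poly to_ac p) x) = form_eval m (map_poly to_ac p) (act x)"
    by simp_all
qed

definition fixed :: "'a alg_closure set" where
  "fixed = {x \<in> sep_closure. \<sigma> x = x}"

sublocale fixed: mult_closed fixed
  using to_ac_in_sep_closure[of 1]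
  by unfold_locales (auto simp: fixed_def hom_mult sep_closure_mult)

text \<open>
  An automorphism permutes the factors of such a product.
\<close>

lemma invariant_prod:
  assumes "bij_betw act Z Z" "\<And>x. x \<in> Z \<Longrightarrow> f x \<in> sep_closure" "\<And>x. x \<in> Z \<Longrightarrow> \<sigma> (f x) = f (act x)"
  shows "prod f Z \<in> fixed"
proof -
  have "\<sigma> (prod f Z) = (\<Prod>x\<in>Z. f (act x))"
    using assms(2,3) by (simp add: hom_prod)
  also have "\<dots> = prod f Z"
    by (rule prod.reindex_bij_betw[OF assms(1)])
  finally show ?thesis
    using assms(2) by (simp add: fixed_def sep_closure_prod)
qed

lemma half_disc_act:
  assumes "set xs \<subseteq> proj_line_over sep_closure"
  shows "half_disc xs \<in> sep_closure" "\<sigma> (half_disc xs) = half_disc (map act xs)"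
proof -
  have "half_disc xs \<in> sep_closure \<and> \<sigma> (half_disc xs) = half_disc (map act xs)"
    using assms
  proof (induction xs)
    case Nil
    show ?case using to_ac_in_sep_closure[of 1] by simp
  next
    case (Cons x xs)
    have "(\<Prod>y\<leftarrow>ys. wedge x y) \<in> sep_closure \<and>
      \<sigma> (\<Prod>y\<leftarrow>ys. wedge x y) = (\<Prod>y\<leftarrow>ys. wedge (act x) (act y))"
      if "set ys \<subseteq> proj_line_over sep_closure" for ys
      using that
    proof (induction ys)
      case Nil
      show ?case using to_ac_in_sep_closure[of 1] by simp
    qed (use Cons.prems in \<open>simp add: wedge_act sep_closure_mult hom_mult\<close>)
    from this[of xs] show ?case
      using Cons by (simp add: sep_closure_mult hom_mult o_def)
  qed
  thus "half_disc xs \<in> sep_closure" "\<sigma> (half_disc xs) = half_disc (map act xs)"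
    by simp_all
qed

end

text \<open>
  A common finite zero would make its minimal polynomial a common divisor of numerator and
  denominator. At infinity one of the two forms has a nonzero leading coefficient.
\<close>

lemma ratfun_no_common_zero:
  fixes \<phi> :: "'a::field poly fract"
  assumes "ratfun_degree \<phi> > 0"
  shows "form_eval (ratfun_degree \<phi>) (ac_num \<phi>) x \<noteq> 0 \<or> form_eval (ratfun_degree \<phi>) (ac_den \<phi>) x \<noteq> 0"
proof (cases x)
  case (Fin a)
  obtain f :: "'a poly" where f: "irreducible f" "poly (map_poly to_ac f) a = 0"
    "\<And>g. poly (map_poly to_ac g) a = 0 \<Longrightarrow> f dvd g"
    by (rule min_poly_exists[of a]) (rule that)
  have "coprime (ratfun_num \<phi>) (ratfun_den \<phi>)"
    using lowest_terms_ratfun[of \<phi>] by (simp add: lowest_terms_def)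
  hence "\<not> (f dvd ratfun_num \<phi> \<and> f dvd ratfun_den \<phi>)"
    using f(1) by (meson coprime_common_divisor irreducible_not_unit)
  thus ?thesis
    using f(3) by (auto simp: Fin)
next
  case Infty
  have "degree (ratfun_num \<phi>) = ratfun_degree \<phi> \<or> degree (ratfun_den \<phi>) = ratfun_degree \<phi>"
    by (auto simp: ratfun_degree_def max_def)
  hence "coeff (ratfun_num \<phi>) (ratfun_degree \<phi>) \<noteq> 0 \<or> coeff (ratfun_den \<phi>) (ratfun_degree \<phi>) \<noteq> 0"
    using assms by (metis degree_0 leading_coeff_0_iff less_irrefl)
  thus ?thesis
    by (auto simp: Infty coeff_map_poly)
qed

section \<open>The Galois action on discriminants\<close>

locale arboreal =
  fixes \<phi> :: "'a::field poly fract"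
  assumes degree_ge_2: "ratfun_degree \<phi> \<ge> 2"
    and two_nonzero: "(2 :: 'a) \<noteq> 0"
    and pcf: "post_critically_finite \<phi>"
    and card_preimages: "\<And>n. n \<ge> 1 \<Longrightarrow> card (iterated_preimage \<phi> n) = ratfun_degree \<phi> ^ n"
begin

abbreviation d :: nat where "d \<equiv> ratfun_degree \<phi>"

sublocale rational_map d "ac_num \<phi>" "ac_den \<phi>"
  using degree_ge_2 ratfun_no_common_zero[of \<phi>]
  by unfold_locales (auto simp: ratfun_degree_def)

lemma rmap_eq: "rmap = ratfun_eval \<phi>"
  by (rule ext) (auto simp: rmap_def ratfun_eval_def split: proj_line.splits)

lemma card_preimages_le: "finite {x. (rmap ^^ n) x = Fin 0} \<and> card {x. (rmap ^^ n) x = Fin 0} \<le> d ^ n"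
proof (induction n)
  case (Suc n)
  have eq: "{x. (rmap ^^ Suc n) x = Fin 0} = (\<Union>y\<in>{x. (rmap ^^ n) x = Fin 0}. fib y)"
    by (auto simp: fib_def funpow_swap1)
  have "card (\<Union>y\<in>{x. (rmap ^^ n) x = Fin 0}. fib y) \<le> (\<Sum>y\<in>{x. (rmap ^^ n) x = Fin 0}. card (fib y))"
    using Suc by (intro card_UN_le) auto
  also have "\<dots> \<le> (\<Sum>y\<in>{x. (rmap ^^ n) x = Fin 0}. d)"
    by (intro sum_mono card_fib_le)
  also have "\<dots> \<le> d ^ n * d"
    using Suc by simp
  finally show ?case
    unfolding eq using Suc by (auto simp: mult.commute)
qed simp

text \<open>
  A level has at most \<open>d ^ n\<close> points over the algebraic closure, and that many are separable, so
  no inseparable preimages exist.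
\<close>

lemma iterated_preimage_eq: "iterated_preimage \<phi> n = {x. (rmap ^^ n) x = Fin 0}"
proof (cases n)
  case 0
  thus ?thesis
    using to_ac_in_sep_closure[of 0] by (auto simp: iterated_preimage_def proj_line_over_def)
next
  case (Suc k)
  hence "n \<ge> 1"
    by simp
  thus ?thesis
    using card_preimages_le[of n] card_preimages[of n]
    by (intro card_seteq) (auto simp: iterated_preimage_def rmap_eq)
qed

sublocale preimage_tree d "ac_num \<phi>" "ac_den \<phi>"
proof unfold_locales
  show "card {x. (rmap ^^ n) x = Fin 0} = d ^ n" for n
    using card_preimages[of n] unfolding iterated_preimage_eq by (cases n) auto
qed

lemma level_eq: "level n = iterated_preimage \<phi> n"
  by (simp add: level_def iterated_preimage_eq)

lemma level_subset: "level n \<subseteq> proj_line_over sep_closure"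
  by (auto simp: level_eq iterated_preimage_def)

lemma wronskian_zero_imp_critical:
  assumes "form_eval (2 * d - 2) wronskian x = 0"
  shows "critical_point \<phi> x"
proof -
  obtain g where g: "fib_form (rmap x) = lin x * (lin x * g)" "degree g \<le> d - 2"
    using wronskian_zero_imp_double[OF assms] by blast
  define F where "F = fibre_poly \<phi> (ratfun_eval \<phi> x)"
  have F: "F = fib_form (rmap x) \<or> F = - fib_form (rmap x)"
    by (cases "rmap x") (auto simp: F_def fibre_poly_def fib_form_def simp flip: rmap_eq)
  hence "F \<noteq> 0"
    using fib_form_nonzero by auto
  show ?thesis
  proof (cases x)
    case (Fin a)
    have "[:-a, 1:] ^ 2 dvd fib_form (rmap x)"
      unfolding g(1) by (simp add: Fin power2_eq_square mult.assoc[symmetric] del: mult_pCons_left mult_pCons_right)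
    hence "[:-a, 1:] ^ 2 dvd F"
      using F by auto
    hence "order a F \<ge> 2"
      using \<open>F \<noteq> 0\<close> by (simp add: order_divides)
    thus ?thesis
      by (simp add: critical_point_def ramification_index_def Fin F_def[unfolded Fin] flip: F_def)
  next
    case Infty
    have "degree F \<le> d - 2"
      using F g by (auto simp: Infty)
    thus ?thesis
      using degree_ge_2 by (simp add: critical_point_def ramification_index_def Infty F_def)
  qed
qed

lemma wronskian_norm_recurrence_pcf:
  obtains m r where "r > 0"
    "\<And>n. n \<ge> m \<Longrightarrow> wronskian_norm (Suc (n + r)) * wronskian_norm n ^ d =
       wronskian_norm (n + r) ^ d * wronskian_norm (Suc n)"
proof (rule wronskian_norm_recurrence)
  show "finite {(rmap ^^ n) c | n. True}" if "form_eval (2 * d - 2) wronskian c = 0" for c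
    using wronskian_zero_imp_critical[OF that] pcf
    unfolding post_critically_finite_def rmap_eq by simp
qed (rule that)

end


definition transposes :: "('b \<Rightarrow> 'b) \<Rightarrow> 'b set \<Rightarrow> 'b \<Rightarrow> 'b \<Rightarrow> bool" where
  "transposes f S a b \<longleftrightarrow>
     a \<in> S \<and> b \<in> S \<and> a \<noteq> b \<and> f a = b \<and> f b = a \<and> (\<forall>x\<in>S - {a, b}. f x = x)"

locale arboreal_galois = arboreal \<phi> + galois_element \<sigma>
  for \<phi> :: "'a::field poly fract" and \<sigma> :: "'a alg_closure \<Rightarrow> 'a alg_closure"
begin

text \<open>
  The separability of the value is a hypothesis so that \<open>\<sigma>\<close> can be applied to the quotient, which
  is then computed by multiplying with the denominator.
\<close>

lemma rmap_act:
  assumes x: "x \<in> proj_line_over sep_closure" and y: "rmap x \<in> proj_line_over sep_closure"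
  shows "act (rmap x) = rmap (act x)"
proof (cases "form_eval d (ac_den \<phi>) x = 0")
  case True
  hence "form_eval d (ac_den \<phi>) (act x) = 0"
    using form_eval_act(2)[OF x, of d "ratfun_den \<phi>"] by simp
  thus ?thesis
    using True by (simp add: rmap_def)
next
  case False
  define u v where "u = form_eval d (ac_num \<phi>) x" and "v = form_eval d (ac_den \<phi>) x"
  have uv: "u \<in> sep_closure" "v \<in> sep_closure" "v \<noteq> 0"
    using form_eval_act(1)[OF x] False by (simp_all add: u_def v_def)
  have uv': "\<sigma> u = form_eval d (ac_num \<phi>) (act x)" "\<sigma> v = form_eval d (ac_den \<phi>) (act x)"
    unfolding u_def v_def by (rule form_eval_act(2)[OF x])+
  have rmap: "rmap x = Fin (u / v)"
    using False by (simp add: rmap_def u_def v_def)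
  hence "u / v \<in> sep_closure"
    using y by (auto simp: proj_line_over_def)
  hence "\<sigma> (u / v) * \<sigma> v = \<sigma> u"
    using uv hom_mult[of "u / v" v] by simp
  moreover have "\<sigma> v \<noteq> 0"
    using uv by (simp add: hom_eq_0_iff)
  ultimately have "\<sigma> (u / v) = \<sigma> u / \<sigma> v"
    by (simp add: field_simps)
  thus ?thesis
    using \<open>\<sigma> v \<noteq> 0\<close> by (simp add: rmap) (simp add: rmap_def uv')
qed

lemma act_level: "x \<in> level n \<Longrightarrow> act x \<in> level n"
proof (induction n arbitrary: x)
  case (Suc n)
  have "rmap x \<in> level n"
    using Suc.prems by (rule rmap_level)
  moreover have "act (rmap x) = rmap (act x)"
    using Suc.prems calculation level_subset by (intro rmap_act) blast+
  ultimately have "rmap (act x) \<in> level n"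
    using Suc.IH by metis
  thus ?case
    by (auto simp: level_Suc fib_def)
qed (simp add: level_0)

lemma bij_level: "bij_betw act (level n) (level n)"
proof -
  have "inj_on act (level n)"
    using act_inj level_subset[of n] by (auto simp: inj_on_def)
  moreover have "act ` level n \<subseteq> level n"
    using act_level by blast
  ultimately show ?thesis
    unfolding bij_betw_def using endo_inj_surj[OF finite_level] by blast
qed

lemma lift_factor_act:
  assumes x: "x \<in> proj_line_over sep_closure"
  shows "lift_factor x \<in> sep_closure" "\<sigma> (lift_factor x) = lift_factor (act x)"
  unfolding lift_factor_def form_eval_act(2)[OF x, symmetric]
  using form_eval_act(1)[OF x] by (simp_all add: hom_eq_0_iff)

lemma coeff_fib_form_act:
  assumes y: "y \<in> proj_line_over sep_closure"
  shows "coeff (fib_form y) i \<in> sep_closure" "\<sigma> (coeff (fib_form y) i) = coeff (fib_form (act y)) i"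
proof -
  have to_ac: "to_ac a \<in> sep_closure" for a :: 'a
    by (rule to_ac_in_sep_closure)
  have "coeff (fib_form y) i \<in> sep_closure \<and> \<sigma> (coeff (fib_form y) i) = coeff (fib_form (act y)) i"
  proof (cases y)
    case (Fin b)
    hence "b \<in> sep_closure"
      using y by (auto simp: proj_line_over_def)
    thus ?thesis
      by (simp add: Fin fib_form_def coeff_map_poly to_ac sep_closure_diff sep_closure_mult
          hom_diff hom_mult)
  next
    case Infty
    thus ?thesis
      by (simp add: fib_form_def coeff_map_poly to_ac sep_closure_uminus hom_uminus)
  qed
  thus "coeff (fib_form y) i \<in> sep_closure" "\<sigma> (coeff (fib_form y) i) = coeff (fib_form (act y)) i"
    by simp_all
qed

text \<open>
  The coefficients of the fibre form are linear in the coordinates of \<open>y\<close> with coefficients in the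
  ground field. A nonzero coefficient stays nonzero under \<open>\<sigma>\<close>, so the degree is preserved.
\<close>

lemma fib_lead_act:
  assumes y: "y \<in> proj_line_over sep_closure"
  shows "fib_lead y \<in> sep_closure" "\<sigma> (fib_lead y) = fib_lead (act y)"
proof -
  have zero: "coeff (fib_form (act y)) i = 0 \<longleftrightarrow> coeff (fib_form y) i = 0" for i
    using coeff_fib_form_act[OF y, of i] by (metis hom_eq_0_iff)
  have deg: "degree (fib_form (act y)) = degree (fib_form y)"
  proof (rule antisym)
    show "degree (fib_form (act y)) \<le> degree (fib_form y)"
      by (rule degree_le) (simp add: zero coeff_eq_0)
    show "degree (fib_form y) \<le> degree (fib_form (act y))"
      by (rule degree_le) (simp add: coeff_eq_0 flip: zero)
  qed
  have Infty: "Infty \<in> proj_line_over sep_closure"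
    by (simp add: proj_line_over_def)
  have "Infty \<in> fib (act y) \<longleftrightarrow> Infty \<in> fib y"
  proof
    assume "Infty \<in> fib y"
    thus "Infty \<in> fib (act y)"
      using rmap_act[OF Infty] y by (simp add: fib_def)
  next
    assume *: "Infty \<in> fib (act y)"
    hence "rmap Infty \<in> proj_line_over sep_closure"
      using y by (simp add: fib_def)
    thus "Infty \<in> fib y"
      using rmap_act[OF Infty] act_inj[of "rmap Infty" y] * y by (simp add: fib_def)
  qed
  thus "fib_lead y \<in> sep_closure" "\<sigma> (fib_lead y) = fib_lead (act y)"
    using coeff_fib_form_act[OF y] by (auto simp: fib_lead_def deg hom_uminus sep_closure_uminus)
qed

lemma disc_fixed: "disc n \<in> fixed"
  unfolding disc_def
proof (rule invariant_prod[OF bij_level])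
  fix x assume x: "x \<in> level n"
  have sub: "y \<in> proj_line_over sep_closure" if "y \<in> level n" for y
    using that level_subset by blast
  show "(\<Prod>x'\<in>level n - {x}. wedge x x') \<in> sep_closure"
    using x sub by (intro sep_closure_prod wedge_act) auto
  have "\<sigma> (\<Prod>x'\<in>level n - {x}. wedge x x') = (\<Prod>x'\<in>level n - {x}. \<sigma> (wedge x x'))"
    using x sub by (intro hom_prod wedge_act) auto
  also have "\<dots> = (\<Prod>x'\<in>level n - {x}. wedge (act x) (act x'))"
    using x sub by (intro prod.cong refl wedge_act) auto
  also have "\<dots> = (\<Prod>x'\<in>level n - {act x}. wedge (act x) x')"
  proof (rule prod.reindex_bij_betw)
    show "bij_betw act (level n - {x}) (level n - {act x})"
      using bij_betw_DiffI[OF bij_level, of "{x}" "{act x}"] x act_level[OF x]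
      by (auto simp: bij_betw_def)
  qed
  finally show "\<sigma> (\<Prod>x'\<in>level n - {x}. wedge x x') = (\<Prod>x'\<in>level n - {act x}. wedge (act x) x')" .
qed

lemma wronskian_eq_map_poly:
  "wronskian = map_poly to_ac (pderiv (ratfun_num \<phi>) * ratfun_den \<phi> - ratfun_num \<phi> * pderiv (ratfun_den \<phi>))"
  by (simp add: wronskian_def map_poly_to_ac_diff map_poly_to_ac_mult pderiv_map_poly_to_ac)

lemma wronskian_prod_fixed: "wronskian_prod n \<in> fixed"
  unfolding wronskian_prod_def wronskian_eq_map_poly
  using level_subset by (intro invariant_prod[OF bij_level] form_eval_act) blast+

lemma lead_prod_fixed: "lead_prod n \<in> fixed"
  unfolding lead_prod_def using level_subset by (intro invariant_prod[OF bij_level] fib_lead_act) blast+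

lemma wronskian_norm_fixed: "wronskian_norm n \<in> fixed"
  by (simp add: wronskian_norm_def lead_upto_def wronskian_prod_fixed lead_prod_fixed fixed.prod_mem)

lemma resultant_fixed: "resultant \<in> fixed"
proof -
  have "(\<Prod>x\<in>level 1. lift_factor x) \<in> fixed"
    using level_subset by (intro invariant_prod[OF bij_level] lift_factor_act) blast+
  moreover have "fib (Fin 0) = level 1"
    by (simp add: level_Suc level_0)
  moreover have "lead_prod 0 = fib_lead (Fin 0)"
    by (simp add: lead_prod_def level_0)
  ultimately show ?thesis
    using lead_prod_fixed[of 0] by (simp add: resultant_def fib_lift_factor_def)
qed

text \<open>
  The product differs from the recurrence for the discriminant by squares of elements of the fixed
  field only.
\<close>

lemma disc_recurrence:
  assumes "n \<ge> 1"
  shows "fixed.sq (disc (Suc n) * (resultant ^ (d ^ n) * disc n ^ d * wronskian_norm (Suc n)))"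
proof (rule fixed.sqI)
  let ?N = "d ^ n"
  let ?s = "lead_prod n ^ (d * (?N - 1))"
  let ?t = "resultant ^ (?N * (?N - 1) div 2) * disc n ^ d * wronskian_prod (Suc n) * lead_upto (Suc n) ^ (d - 1)"
  have "even (?N * (?N - 1))"
    using assms by auto
  hence half: "resultant ^ (?N * (?N - 1)) = (resultant ^ (?N * (?N - 1) div 2)) ^ 2"
    by (metis dvd_mult_div_cancel power_mult mult.commute)
  have lead_prod: "lead_upto (Suc n) ^ (2 * d - 2) = (lead_upto (Suc n) ^ (d - 1)) ^ 2"
  proof -
    have "2 * d - 2 = (d - 1) * 2"
      by (simp add: diff_mult_distrib)
    thus ?thesis
      by (simp only: power_mult)
  qed
  have "disc (Suc n) * (resultant ^ ?N * disc n ^ d * wronskian_norm (Suc n)) * ?s ^ 2 =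
      (disc (Suc n) * ?s ^ 2 * resultant ^ ?N) * (disc n ^ d * wronskian_prod (Suc n) * lead_upto (Suc n) ^ (2 * d - 2))"
    by (simp add: wronskian_norm_def mult_ac)
  also have "\<dots> = ?t ^ 2"
    unfolding disc_Suc half lead_prod by (simp add: power2_eq_square mult_ac)
  finally show "disc (Suc n) * (resultant ^ ?N * disc n ^ d * wronskian_norm (Suc n)) * ?s ^ 2 = ?t ^ 2" .
  show "?s \<in> fixed - {0}"
    using lead_prod_fixed by simp
  have "lead_upto (Suc n) \<in> fixed"
    unfolding lead_upto_def using lead_prod_fixed by (intro fixed.prod_mem)
  thus "?t \<in> fixed - {0}"
    using resultant_fixed disc_fixed wronskian_prod_fixed by simp
qed

text \<open>
  The discriminants of all levels \<open>n, n + 4 * r, n + 8 * r, \<dots>\<close> differ by squares of the fixed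
  field, and \<open>r\<close> is independent of the automorphism.
\<close>

lemma disc_same_class:
  assumes "m \<ge> 1"
    and "\<And>n. n \<ge> m \<Longrightarrow> wronskian_norm (Suc (n + r)) * wronskian_norm n ^ d = wronskian_norm (n + r) ^ d * wronskian_norm (Suc n)"
    and "n > m"
  shows "fixed.sq (disc n * disc (n + 4 * r * i))"
proof (rule fixed.sq_steps)
  have norm: "wronskian_norm n \<in> fixed - {0}" if "n \<ge> m" for n
    using wronskian_norm_fixed[of n] wronskian_norm_nonzero[of "n - 1"] that assms(1) by simp
  show "fixed.sq (disc n * disc (n + 4 * r))" if "n \<ge> Suc m" for n
  proof (rule fixed.sq_periodic[of m disc wronskian_norm resultant d r])
    show "fixed.sq (disc (Suc n) * (resultant ^ (d ^ n) * disc n ^ d * wronskian_norm (Suc n)))" if "n \<ge> m" for n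
      using that assms(1) by (intro disc_recurrence) simp
  qed (use assms norm that in \<open>auto simp: disc_fixed resultant_fixed\<close>)
  show "disc n \<in> fixed - {0}" for n
    using disc_fixed by simp
qed (use assms in simp)

text \<open>
  The product \<open>h\<close> of square roots of the two discriminants is fixed by \<open>\<sigma>\<close>, because
  \<open>(h * s) ^ 2 = t ^ 2\<close> with nonzero elements \<open>s\<close> and \<open>t\<close> of the fixed field. But \<open>\<sigma>\<close> fixes the first square root, and a transposition
  would change the sign of the second. The signs relating discriminants to squares agree on both
  levels because \<open>d ^ n\<close> and \<open>d ^ (n + 4 * k)\<close> are congruent modulo 4.
\<close>

lemma not_transposition:
  assumes sq: "fixed.sq (disc n * disc (n + 4 * k))" and n: "n \<ge> 2"
    and fixed: "\<forall>x\<in>level n. act x = x"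
  shows "\<not> transposes act (level (n + 4 * k)) a b"
proof
  assume "transposes act (level (n + 4 * k)) a b"
  hence ab: "a \<in> level (n + 4 * k)" "b \<in> level (n + 4 * k)" "a \<noteq> b"
    and swap: "act a = b" "act b = a" "\<And>x. x \<in> level (n + 4 * k) - {a, b} \<Longrightarrow> act x = x"
    by (simp_all add: transposes_def)
  obtain xs where xs: "distinct xs" "set xs = level n"
    using finite_distinct_list[OF finite_level] by blast
  obtain ys where ys: "distinct ys" "set ys = level (n + 4 * k) - {a, b}"
    using finite_distinct_list[of "level (n + 4 * k) - {a, b}"] by auto
  define zs where "zs = a # b # ys"
  have zs: "distinct zs" "set zs = level (n + 4 * k)"
    using ys ab by (auto simp: zs_def)
  have len: "length xs = d ^ n" "length zs = d ^ (n + 4 * k)"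
    using xs zs distinct_card[of xs] distinct_card[of zs] by simp_all
  obtain s t where st: "s \<in> fixed - {0}" "t \<in> fixed - {0}"
      "disc n * disc (n + 4 * k) * s ^ 2 = t ^ 2"
    using sq unfolding fixed.sq_def by blast
  have parity: "even (d ^ (n + 4 * k) choose 2) \<longleftrightarrow> even (d ^ n choose 2)"
    using n d_ge_2 by (intro power_choose_two_parity) auto
  define h where "h = half_disc xs * half_disc zs"
  have "disc n * disc (n + 4 * k) = h ^ 2"
    using half_disc_squared[OF xs(1)] half_disc_squared[OF zs(1)] parity
    by (simp add: disc_def xs(2) zs(2) len h_def power_mult_distrib minus_one_power_iff)
  hence "(h * s) ^ 2 = t ^ 2"
    using st(3) by (simp add: power_mult_distrib)
  hence hs: "h * s = t \<or> h * s = - t"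
    by (simp add: power2_eq_iff)
  have sep: "half_disc xs \<in> sep_closure" "half_disc zs \<in> sep_closure"
    using level_subset xs zs by (auto intro!: half_disc_act(1))
  have "map act xs = xs"
    using fixed xs by (intro map_idI) auto
  hence \<sigma>1: "\<sigma> (half_disc xs) = half_disc xs"
    using half_disc_act(2)[of xs] level_subset[of n] xs by simp
  have "map act ys = ys"
    using swap(3) ys by (intro map_idI) auto
  hence "map act zs = b # a # ys"
    using swap by (simp add: zs_def)
  hence \<sigma>2: "\<sigma> (half_disc zs) = - half_disc zs"
    using half_disc_act(2)[of zs] level_subset[of "n + 4 * k"] half_disc_swap[of b a ys]
    unfolding zs(2)[symmetric] by (simp add: zs_def del: half_disc.simps)
  have st': "s \<in> sep_closure" "t \<in> sep_closure" "\<sigma> s = s" "\<sigma> t = t" "s \<noteq> 0"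
    using st by (auto simp: fixed_def)
  have h: "h \<in> sep_closure" "\<sigma> h = - h"
    using sep by (simp_all add: h_def sep_closure_mult hom_mult \<sigma>1 \<sigma>2)
  have "\<sigma> (h * s) = h * s"
    using hs st' by (auto simp: hom_uminus)
  moreover have "\<sigma> (h * s) = - (h * s)"
    using h st' by (simp add: hom_mult)
  ultimately have "to_ac 2 * (h * s) = 0"
    by (simp add: eq_neg_iff_add_eq_0)
  moreover have "h \<noteq> 0"
    using half_disc_nonzero[OF xs(1)] half_disc_nonzero[OF zs(1)] by (simp add: h_def)
  ultimately show False
    using two_nonzero st' by (simp del: to_ac_numeral)
qed

end

lemma (in arboreal) no_transposition_above_trivial_level:
  "\<exists>n. \<exists>p>0. \<forall>\<sigma>\<in>galois_sep. (\<forall>x\<in>level n. map_proj_line \<sigma> x = x) \<longrightarrow>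
     (\<forall>i a b. \<not> transposes (map_proj_line \<sigma>) (level (n + p * i)) a b)"
proof -
  obtain m r where mr: "r > 0"
    "\<And>n. n \<ge> m \<Longrightarrow> wronskian_norm (Suc (n + r)) * wronskian_norm n ^ d =
       wronskian_norm (n + r) ^ d * wronskian_norm (Suc n)"
    by (rule wronskian_norm_recurrence_pcf) (rule that)
  \<comment> \<open>The summand 2 makes the parity of \<open>d ^ n choose 2\<close> stable, and \<open>n\<close> exceeds the preperiod \<open>m + 1\<close> used below.\<close>
  define n where "n = m + 2"
  have "\<not> transposes (map_proj_line \<sigma>) (level (n + 4 * r * i)) a b"
    if "\<sigma> \<in> galois_sep" "\<forall>x\<in>level n. map_proj_line \<sigma> x = x"
    for \<sigma> :: "'a alg_closure \<Rightarrow> 'a alg_closure" and i a b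
  proof -
    interpret arboreal_galois \<phi> \<sigma>
      by unfold_locales (rule that)
    have "fixed.sq (disc n * disc (n + 4 * (r * i)))"
      using disc_same_class[of "m + 1" r n i] mr by (simp add: n_def mult.assoc)
    thus ?thesis
      using not_transposition[of n "r * i" a b] that(2) by (simp add: n_def mult.assoc)
  qed
  thus ?thesis
    using mr(1) by (intro exI[of _ n] exI[of _ "4 * r"]) simp
qed


section \<open>Automorphisms of the preimage tree\<close>

context arboreal
begin

lemma tree_verts_iff: "(n, x) \<in> tree_verts \<phi> \<longleftrightarrow> x \<in> level n"
  by (simp add: tree_verts_def level_eq)

lemma tree_edges_eq:
  "{(n, x), (k, y)} \<in> tree_edges \<phi> \<longleftrightarrow>
    (n = Suc k \<and> x \<in> level n \<and> y = rmap x) \<or> (k = Suc n \<and> y \<in> level k \<and> x = rmap y)"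
  by (auto simp: tree_edges_def doubleton_eq_iff rmap_eq level_eq)

definition levelwise_aut :: "(nat \<Rightarrow> 'a alg_closure proj_line \<Rightarrow> 'a alg_closure proj_line) \<Rightarrow> bool" where
  "levelwise_aut g \<longleftrightarrow>
     (\<forall>n. bij_betw (g n) (level n) (level n)) \<and>
     (\<forall>n. \<forall>x\<in>level (Suc n). rmap (g (Suc n) x) = g n (rmap x))"

text \<open>
  A family of bijections of the levels that commutes with taking parents is the same thing as an
  automorphism of the rooted tree.
\<close>

lemma levelwise_aut_in_carrier:
  assumes "levelwise_aut g"
  shows "(\<lambda>(n, x)\<in>tree_verts \<phi>. (n, g n x)) \<in> carrier (tree_aut_group \<phi>)"
proof -
  have bij: "bij_betw (g n) (level n) (level n)"
    and comm: "x \<in> level (Suc n) \<Longrightarrow> rmap (g (Suc n) x) = g n (rmap x)" for n x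
    using assms by (auto simp: levelwise_aut_def)
  let ?G = "\<lambda>(n, x)\<in>tree_verts \<phi>. (n, g n x)"
  have mem: "g n x \<in> level n" if "x \<in> level n" for n x
    using bij[of n] that by (auto simp: bij_betw_def)
  have inj: "g n x = g n y \<longleftrightarrow> x = y" if "x \<in> level n" "y \<in> level n" for n x y
    using bij[of n] that by (auto simp: bij_betw_def inj_on_def)
  have G: "?G (n, x) = (n, g n x)" if "x \<in> level n" for n x
    using that by (simp add: tree_verts_iff)
  have "bij_betw ?G (tree_verts \<phi>) (tree_verts \<phi>)"
    unfolding bij_betw_def
  proof
    show "inj_on ?G (tree_verts \<phi>)"
      by (rule inj_onI) (auto simp: tree_verts_iff inj)
    show "?G ` tree_verts \<phi> = tree_verts \<phi>"
    proof
      show "?G ` tree_verts \<phi> \<subseteq> tree_verts \<phi>"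
        by (auto simp: tree_verts_iff mem)
      show "tree_verts \<phi> \<subseteq> ?G ` tree_verts \<phi>"
      proof
        fix v assume v: "v \<in> tree_verts \<phi>"
        obtain n y where ny: "v = (n, y)" by (cases v)
        with v have "y \<in> level n" by (simp add: tree_verts_iff)
        hence "y \<in> g n ` level n"
          using bij[of n] by (simp add: bij_betw_def)
        then obtain x where x: "x \<in> level n" "g n x = y"
          by blast
        thus "v \<in> ?G ` tree_verts \<phi>"
          using G[OF x(1)] ny x by (intro image_eqI[of _ _ "(n, x)"]) (simp_all add: tree_verts_iff)
      qed
    qed
  qed
  moreover have "?G tree_root = tree_root"
  proof -
    have "g 0 (Fin 0) = Fin 0"
      using mem[of "Fin 0" 0] by (simp add: level_0)
    thus ?thesis
      using G[of "Fin 0" 0] by (simp add: tree_root_def level_0)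
  qed
  moreover have "{?G u, ?G v} \<in> tree_edges \<phi> \<longleftrightarrow> {u, v} \<in> tree_edges \<phi>"
    if uv: "u \<in> tree_verts \<phi>" "v \<in> tree_verts \<phi>" for u v
  proof -
    obtain n x k y where [simp]: "u = (n, x)" "v = (k, y)"
      by (cases u, cases v)
    have xy: "x \<in> level n" "y \<in> level k"
      using uv by (simp_all add: tree_verts_iff)
    have parent: "g k y = rmap (g (Suc k) x) \<longleftrightarrow> y = rmap x"
      if "x \<in> level (Suc k)" "y \<in> level k" for x y k
      using that by (simp add: comm inj rmap_level)
    have "{(n, g n x), (k, g k y)} \<in> tree_edges \<phi> \<longleftrightarrow> {(n, x), (k, y)} \<in> tree_edges \<phi>"
      unfolding tree_edges_eq using xy parent[of x k y] parent[of y n x] mem by auto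
    thus ?thesis
      using G xy by simp
  qed
  moreover have "?G \<in> extensional (tree_verts \<phi>)"
    by simp
  ultimately show ?thesis
    by (simp add: tree_aut_group_def rooted_graph_auts_def Bij_def)
qed

lemma galois_tree_action_in_carrier:
  assumes "\<sigma> \<in> galois_sep"
  shows "galois_tree_action \<phi> \<sigma> \<in> carrier (tree_aut_group \<phi>)"
proof -
  interpret arboreal_galois \<phi> \<sigma>
    by unfold_locales (rule assms)
  have "rmap (act x) = act (rmap x)" if "x \<in> level (Suc n)" for n x
    using that rmap_level[OF that] level_subset by (intro rmap_act[symmetric]) blast+
  thus ?thesis
    unfolding galois_tree_action_def using bij_level
    by (intro levelwise_aut_in_carrier) (simp add: levelwise_aut_def)
qed

lemma carrier_mult:
  assumes "f \<in> carrier (tree_aut_group \<phi>)" "g \<in> carrier (tree_aut_group \<phi>)"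
  shows "f \<otimes>\<^bsub>tree_aut_group \<phi>\<^esub> g = compose (tree_verts \<phi>) f g"
  using assms by (simp add: tree_aut_group_def rooted_graph_auts_def BijGroup_def)

text \<open>
  The identity automorphism acts trivially, since all vertices are separable.
\<close>

lemma one_in_arboreal_galois_group:
  "(\<lambda>v\<in>tree_verts \<phi>. v) \<in> arboreal_galois_group \<phi>"
proof -
  have "map_proj_line (restrict id sep_closure) x = x" if "x \<in> level n" for n x
    using that level_subset[of n] by (cases x) (auto simp: proj_line_over_def)
  hence "galois_tree_action \<phi> (restrict id sep_closure) = (\<lambda>v\<in>tree_verts \<phi>. v)"
    unfolding galois_tree_action_def
    by (intro restrict_ext) (auto simp: tree_verts_iff)
  thus ?thesis
    unfolding arboreal_galois_group_def using id_in_galois_sep by force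
qed

text \<open>
  Above level \<open>k\<close> the automorphism is built level by level. The fibres over \<open>y\<close> and over its image
  have the same size \<open>d\<close>, and \<open>e\<close> chooses a bijection between any two fibres.
\<close>

lemma level_automorphism_extends:
  assumes h: "bij_betw h (level k) (level k)"
    "\<And>x. x \<in> level k \<Longrightarrow> k > 0 \<Longrightarrow> rmap (h x) = rmap x"
  obtains g where "levelwise_aut g" "g k = h" "\<And>n x. n < k \<Longrightarrow> g n x = x"
proof -
  define e where "e = (\<lambda>y y'. SOME e. bij_betw e (fib y) (fib y'))"
  have e: "bij_betw (e y y') (fib y) (fib y')" if "y \<in> level n" "y' \<in> level n" for n y y'
  proof -
    have "\<exists>e. bij_betw e (fib y) (fib y')"
      using card_fib[OF that(1)] card_fib[OF that(2)] by (intro finite_same_card_bij) simp_all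
    thus ?thesis
      unfolding e_def by (rule someI_ex)
  qed
  define G where "G = rec_nat h (\<lambda>_ g x. e (rmap x) (g (rmap x)) x)"
  have G: "G 0 = h" "G (Suc j) = (\<lambda>x. e (rmap x) (G j (rmap x)) x)" for j
    by (simp_all add: G_def)
  have G_bij: "bij_betw (G j) (level (k + j)) (level (k + j))" for j
  proof (induction j)
    case (Suc j)
    have mem: "G j y \<in> level (k + j)" if "y \<in> level (k + j)" for y
      using Suc that by (auto simp: bij_betw_def)
    have ee: "bij_betw (e y (G j y)) (fib y) (fib (G j y))" if "y \<in> level (k + j)" for y
      using e that mem by blast
    have "inj_on (G (Suc j)) (level (k + Suc j))"
    proof (rule inj_onI)
      fix x x' assume x: "x \<in> level (k + Suc j)" "x' \<in> level (k + Suc j)"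
        and eq: "G (Suc j) x = G (Suc j) x'"
      have r: "rmap x \<in> level (k + j)" "rmap x' \<in> level (k + j)"
        using x rmap_level by auto
      have in_fib: "G (Suc j) z \<in> fib (G j (rmap z))" if "rmap z \<in> level (k + j)" for z
        using ee[OF that] by (auto simp: G fib_def bij_betw_def)
      have "G j (rmap x) = G j (rmap x')"
        using in_fib[OF r(1)] in_fib[OF r(2)] eq by (simp add: fib_def)
      hence "rmap x = rmap x'"
        using Suc r by (auto simp: bij_betw_def inj_on_def)
      thus "x = x'"
        using eq ee[OF r(1)] by (auto simp: G bij_betw_def inj_on_def fib_def)
    qed
    moreover have "G (Suc j) ` level (k + Suc j) \<subseteq> level (k + Suc j)"
    proof
      fix z assume "z \<in> G (Suc j) ` level (k + Suc j)"
      then obtain x where x: "x \<in> level (k + Suc j)" "z = G (Suc j) x" by blast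
      hence "rmap x \<in> level (k + j)"
        using rmap_level by auto
      moreover from this have "z \<in> fib (G j (rmap x))"
        using ee[of "rmap x"] by (auto simp: x(2) G fib_def bij_betw_def)
      ultimately show "z \<in> level (k + Suc j)"
        using mem by (auto simp: level_Suc)
    qed
    ultimately show ?case
      unfolding bij_betw_def using endo_inj_surj[OF finite_level] by blast
  qed (use h in \<open>simp add: G\<close>)
  define g where "g = (\<lambda>n. if n < k then id else G (n - k))"
  have "levelwise_aut g"
    unfolding levelwise_aut_def
  proof (intro conjI allI ballI)
    show "bij_betw (g n) (level n) (level n)" for n
      using G_bij[of "n - k"] by (cases "n < k") (simp_all add: g_def)
    show "rmap (g (Suc n) x) = g n (rmap x)" if x: "x \<in> level (Suc n)" for n x
    proof -
      consider "Suc n < k" | "Suc n = k" | "n \<ge> k" by linarith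
      thus ?thesis
      proof cases
        case 2
        thus ?thesis using h(2)[of x] x by (simp add: g_def G)
      next
        case 3
        have r: "rmap x \<in> level n"
          using x by (rule rmap_level)
        hence "G (n - k) (rmap x) \<in> level n"
          using G_bij[of "n - k"] 3 by (auto simp: bij_betw_def)
        hence "bij_betw (e (rmap x) (G (n - k) (rmap x))) (fib (rmap x)) (fib (G (n - k) (rmap x)))"
          using e r by blast
        hence "e (rmap x) (G (n - k) (rmap x)) x \<in> fib (G (n - k) (rmap x))"
          by (auto simp: bij_betw_def fib_def)
        thus ?thesis
          using 3 by (simp add: g_def G Suc_diff_le fib_def)
      qed (simp add: g_def)
    qed
  qed
  moreover have "g k = h" "\<And>n x. n < k \<Longrightarrow> g n x = x"
    by (simp_all add: g_def G)
  ultimately show ?thesis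
    by (rule that)
qed

lemma sibling_transposition:
  assumes "k > 0"
  obtains g a b where "levelwise_aut g" "\<And>n x. n < k \<Longrightarrow> g n x = x" "transposes (g k) (level k) a b"
proof -
  obtain k' where k': "k = Suc k'"
    using assms by (cases k) auto
  have "level k' \<noteq> {}"
    using card_level'[of k'] d_ge_2 by (metis card.empty not_numeral_le_zero power_eq_0_iff)
  then obtain y where y: "y \<in> level k'" by blast
  obtain a b where ab: "a \<in> fib y" "b \<in> fib y" "a \<noteq> b"
    using card_fib[OF y] d_ge_2 finite_fib[of y] by (metis card_le_Suc0_iff_eq not_less_eq_eq numeral_2_eq_2)
  define h where "h = (\<lambda>x. if x = a then b else if x = b then a else x)"
  have ab': "a \<in> level k" "b \<in> level k"
    using ab y by (auto simp: k' level_Suc)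
  have "bij_betw h (level k) (level k)"
    by (rule bij_betwI[where g = h]) (use ab' in \<open>auto simp: h_def\<close>)
  moreover have "rmap (h x) = rmap x" for x
    using ab by (auto simp: h_def fib_def)
  ultimately obtain g where "levelwise_aut g" "g k = h" "\<And>n x. n < k \<Longrightarrow> g n x = x"
    using level_automorphism_extends[of h k] by metis
  moreover have "transposes h (level k) a b"
    using ab ab' by (auto simp: transposes_def h_def)
  ultimately show ?thesis
    using that by metis
qed

text \<open>
  Let \<open>A i\<close> be an automorphism that is trivial below level \<open>k i = n + p * (i + 1)\<close> and a
  transposition on that level. If \<open>A i\<close> and \<open>A j\<close> with \<open>i < j\<close> were in the same coset, a Galois
  automorphism would act as \<open>A i\<close> on all levels below \<open>k j\<close>, where \<open>A j\<close> is trivial. It would be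
  trivial on level \<open>n\<close> and a transposition on level \<open>k i\<close>.
\<close>

theorem infinite_index: "infinite (rcosets\<^bsub>tree_aut_group \<phi>\<^esub> (arboreal_galois_group \<phi>))"
proof -
  obtain n p where p: "p > 0" and no_transposition:
    "\<And>\<sigma> i a b. \<sigma> \<in> galois_sep \<Longrightarrow> \<forall>x\<in>level n. map_proj_line \<sigma> x = x \<Longrightarrow>
       \<not> transposes (map_proj_line \<sigma>) (level (n + p * i)) a b"
    using no_transposition_above_trivial_level by blast
  define k where "k = (\<lambda>i. n + p * Suc i)"
  have k_less: "n < k i" "i < j \<Longrightarrow> k i < k j" for i j
    using p by (simp_all add: k_def)
  have "\<exists>g a b. levelwise_aut g \<and> (\<forall>n x. n < k i \<longrightarrow> g n x = x) \<and> transposes (g (k i)) (level (k i)) a b"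
    for i
  proof -
    have "k i > 0"
      using k_less(1)[of i] by simp
    thus ?thesis
      by (rule sibling_transposition) blast
  qed
  then obtain g a b where g: "\<And>i. levelwise_aut (g i)" "\<And>i n x. n < k i \<Longrightarrow> g i n x = x"
    "\<And>i. transposes (g i (k i)) (level (k i)) (a i) (b i)"
    by metis
  define A where "A = (\<lambda>i. \<lambda>(n, x)\<in>tree_verts \<phi>. (n, g i n x))"
  have A: "A i \<in> carrier (tree_aut_group \<phi>)" for i
    unfolding A_def using g(1) by (rule levelwise_aut_in_carrier)
  have A_apply: "A i (n, x) = (n, g i n x)" if "x \<in> level n" for i n x
    using that by (simp add: A_def tree_verts_iff)
  define cos where "cos = (\<lambda>i. arboreal_galois_group \<phi> #>\<^bsub>tree_aut_group \<phi>\<^esub> A i)"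
  have "cos i \<noteq> cos j" if ij: "i < j" for i j
  proof
    assume eq: "cos i = cos j"
    have "compose (tree_verts \<phi>) (\<lambda>v\<in>tree_verts \<phi>. v) (A i) = A i"
      using A[of i]
      by (intro Id_compose) (auto simp: tree_aut_group_def rooted_graph_auts_def Bij_def bij_betw_def)
    moreover have "(\<lambda>v\<in>tree_verts \<phi>. v) \<otimes>\<^bsub>tree_aut_group \<phi>\<^esub> A i \<in> cos i"
      using one_in_arboreal_galois_group by (auto simp: cos_def r_coset_def)
    moreover have "(\<lambda>v\<in>tree_verts \<phi>. v) \<in> carrier (tree_aut_group \<phi>)"
      using one_in_arboreal_galois_group galois_tree_action_in_carrier
      by (auto simp: arboreal_galois_group_def)
    ultimately have "A i \<in> cos i"
      using carrier_mult A by metis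
    hence "A i \<in> cos j"
      using eq by simp
    then obtain \<sigma> where \<sigma>: "\<sigma> \<in> galois_sep"
      "A i = compose (tree_verts \<phi>) (galois_tree_action \<phi> \<sigma>) (A j)"
      using carrier_mult galois_tree_action_in_carrier A
      by (auto simp: cos_def r_coset_def arboreal_galois_group_def)
    have act: "map_proj_line \<sigma> x = g i m x" if x: "x \<in> level m" and m: "m < k j" for m x
    proof -
      have "A i (m, x) = galois_tree_action \<phi> \<sigma> (A j (m, x))"
        using \<sigma>(2) x by (simp add: compose_eq tree_verts_iff)
      thus ?thesis
        using x m g(2) by (simp add: A_apply galois_tree_action_def tree_verts_iff)
    qed
    have act_k: "map_proj_line \<sigma> x = g i (k i) x" if "x \<in> level (k i)" for x
      using that k_less(2)[OF ij] by (rule act)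
    have "\<forall>x\<in>level n. map_proj_line \<sigma> x = x"
    proof
      fix x assume x: "x \<in> level n"
      show "map_proj_line \<sigma> x = x"
        using act[OF x] g(2)[of n i x] k_less(1) by simp
    qed
    hence "\<not> transposes (map_proj_line \<sigma>) (level (k i)) (a i) (b i)"
      unfolding k_def by (intro no_transposition \<sigma>(1))
    moreover have "transposes (map_proj_line \<sigma>) (level (k i)) (a i) (b i)"
      using g(3)[of i] by (simp add: transposes_def act_k)
    ultimately show False
      by contradiction
  qed
  hence "inj cos"
    by (metis injI linorder_neqE_nat)
  hence "infinite (range cos)"
    by (simp add: finite_image_iff)
  moreover have "range cos \<subseteq> rcosets\<^bsub>tree_aut_group \<phi>\<^esub> (arboreal_galois_group \<phi>)"
    using A by (auto simp: cos_def RCOSETS_def)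
  ultimately show ?thesis
    using finite_subset by blast
qed

end

theorem theorem3p1:
  fixes d :: nat and \<phi> :: "'a::field poly fract"
  assumes "d \<ge> 2"
    and "global_field TYPE('a)"
    and "CHAR('a) = 0 \<or> CHAR('a) > d"
    and "ratfun_degree \<phi> = d"
    and "post_critically_finite \<phi>"
    and "\<And>n. n \<ge> 1 \<Longrightarrow>
           card {x \<in> proj_line_over sep_closure. (ratfun_eval \<phi> ^^ n) x = Fin 0} = d ^ n"
  shows "infinite (rcosets\<^bsub>tree_aut_group \<phi>\<^esub> (arboreal_galois_group \<phi>))"
proof -
  have "\<not> CHAR('a) dvd 2"
    using assms(1,3) by (auto dest: dvd_imp_le)
  hence "(2 :: 'a) \<noteq> 0"
    using of_nat_eq_0_iff_char_dvd[where ?'a = 'a, of 2] by simp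
  then interpret arboreal \<phi>
    using assms by unfold_locales (simp_all add: iterated_preimage_def)
  show ?thesis
    by (rule infinite_index)
qed

end
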